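(* Let $\mathcal H_N$ be a finite-dimensional Hilbert space with a fixed orthonormal basis $\{|n\rangle\}_{n=1}^{|N|}$, and assume $\mathcal H_N$ admits a full set of $|N|+1$ mutually unbiased bases, represented by unitaries $\{U_N^\theta\}_{\theta=1}^{|N|+1}$ mapping the $\theta$-th basis to the fixed basis. Let $\mathcal P=\{P^j\}_{j=1}^{|\mathcal P|}$ be a set of pairwise independent permutations of $\{1,\dots,|N|\}$, acting on $\mathcal H_N$ by $P_N^j|n\rangle=|P^j(n)\rangle$. Then, the set of unitaries $$\left\{P_N^jU_N^\theta:\ j\in\{1,\dots,|\mathcal P|\},\ \theta\in\{1,\dots,|N|+1\}\right\}$$ defines a strong $(k,\varepsilon)$ quantum-classical min-entropy extractor against quantum side information with input size $n=\log|N|$, output size $$m=\min\left\{n,\ n+k-2\log\frac1\varepsilon-2\right\},$$ and seed size $d=\log|\mathcal P|+\log(|N|+1)$. For example, for the set of permutations $\{x\mapsto a\cdot x+b:a\in X^*,b\in X\}$ of a finite field $X$ with $|X|=|N|$ this shows that a seed size of $d=3n$ is achievable.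
   Context: Logarithms are base 2; all spaces are finite-dimensional; $|N|=\dim\mathcal H_N$. Bases are mutually unbiased if $|\langle\theta_k|\theta'_{k'}\rangle|=1/\sqrt{|N|}$ for all $k,k'$ and $\theta\ne\theta'$. A family $\mathcal P$ of permutations of a set $X$ is pairwise independent if for all $x_1\ne x_2$, $y_1\ne y_2$ and $\pi$ uniform in $\mathcal P$, $\Pr\{\pi(x_1)=y_1,\pi(x_2)=y_2\}=\frac1{|X|(|X|-1)}$. Measurement map: for $\mathcal H_M\subset\mathcal H_N$, i.e. $\mathcal H_N=\mathcal H_M\otimes\mathcal H_{N\backslash M}$ with the fixed basis labelled as $|mm'\rangle$, set $\mathcal T_{N\to M}(\cdot)=\sum_{m,m'}\langle mm'|(\cdot)|mm'\rangle\,|m\rangle\langle m|_M$ (discard $N\backslash M$ and measure $M$). Strong $(k,\varepsilon)$ quantum-classical min-entropy extractor against quantum side information ($k\in[-\log|N|,\log|N|]$, $\varepsilon>0$): unitaries $\{V^1,\dots,V^{|D|}\}$ on $\mathcal H_N$ such that for all finite-dimensional $\mathcal H_R$ and all density matrices $\rho_{NR}$ with $H_{\min}(N|R)_\rho\ge k$, $$\left\|\frac1{|D|}\sum_{i=1}^{|D|}\mathcal T_{N\to M}\left(V^i\rho_{NR}(V^i)^\dagger\right)\otimes|i\rangle\langle i|_D-\frac{1_M}{|M|}\otimes\rho_R\otimes\frac{1_D}{|D|}\right\|_1\le\varepsilon .$$ Input size is $\log|N|$, output size $\log|M|$, seed size $\log|D|$. Conditional min-entropy: $H_{\min}(N|R)_\rho=-\min_{\sigma_R}\inf\{\mu\in\mathbb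 R:\rho_{NR}\le2^\mu\,1_N\otimes\sigma_R\}$, minimum over density matrices $\sigma_R$. *)

theory Defs
  imports
    Complex_Main
    "HOL-Library.Extended_Real"
    "HOL-Combinatorics.Permutations"
    "Jordan_Normal_Form.Schur_Decomposition"
begin

text \<open>
  An \<open>n\<close>-dimensional Hilbert space is \<open>carrier_vec n\<close> over the complex numbers, the fixed
  orthonormal basis is \<open>unit_vec n 0, \<dots>, unit_vec n (n - 1)\<close>, and operators are
  complex matrices. In a tensor product of spaces of dimensions \<open>a\<close> and \<open>b\<close>, the product basis
  vector of \<open>i < a\<close> and \<open>j < b\<close> has index \<open>i * b + j\<close>.
\<close>

definition kron :: "complex mat \<Rightarrow> complex mat \<Rightarrow> complex mat" where
  "kron A B = mat (dim_row A * dim_row B) (dim_col A * dim_col B)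
     (\<lambda>(i, j). A $$ (i div dim_row B, j div dim_col B) * B $$ (i mod dim_row B, j mod dim_col B))"

definition basis_proj :: "nat \<Rightarrow> nat \<Rightarrow> complex mat" where
  "basis_proj n x = mat n n (\<lambda>(i, j). if i = x \<and> j = x then 1 else 0)"

text \<open>The type of matrices is not a monoid under addition, hence this explicit sum of
  \<open>n \<times> n\<close> matrices.\<close>

definition mat_sum :: "nat \<Rightarrow> ('i \<Rightarrow> complex mat) \<Rightarrow> 'i set \<Rightarrow> complex mat" where
  "mat_sum n f I = mat n n (\<lambda>ij. \<Sum>x\<in>I. f x $$ ij)"

definition mat_trace :: "complex mat \<Rightarrow> complex" where
  "mat_trace A = (\<Sum>i<dim_row A. A $$ (i, i))"

definition unitary_mat :: "nat \<Rightarrow> complex mat \<Rightarrow> bool" where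
  "unitary_mat n U \<longleftrightarrow> U \<in> carrier_mat n n \<and>
     mat_adjoint U * U = 1\<^sub>m n \<and> U * mat_adjoint U = 1\<^sub>m n"

text \<open>For complex \<open>z\<close>, the order makes \<open>0 \<le> z\<close> say that \<open>z\<close> is real and nonnegative, so the
  following condition includes that \<open>A\<close> is Hermitian.\<close>

definition psd :: "nat \<Rightarrow> complex mat \<Rightarrow> bool" where
  "psd n A \<longleftrightarrow> A \<in> carrier_mat n n \<and> (\<forall>v \<in> carrier_vec n. 0 \<le> (A *\<^sub>v v) \<bullet>c v)"

definition density :: "nat \<Rightarrow> complex mat \<Rightarrow> bool" where
  "density n \<rho> \<longleftrightarrow> psd n \<rho> \<and> mat_trace \<rho> = 1"

text \<open>The choice is unambiguous, since a positive semidefinite matrix has exactly one positive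
  semidefinite square root.\<close>

definition psd_sqrt :: "nat \<Rightarrow> complex mat \<Rightarrow> complex mat" where
  "psd_sqrt n A = (SOME S. psd n S \<and> S * S = A)"

definition trace_norm :: "complex mat \<Rightarrow> real" where
  "trace_norm A = Re (mat_trace (psd_sqrt (dim_col A) (mat_adjoint A * A)))"

text \<open>For an operator \<open>X\<close> on a tensor product whose second factor has dimension \<open>r\<close>, this is the
  operator \<open>\<langle>x|X|x\<rangle>\<close> on that second factor (\<open>|x\<rangle>\<close> a vector of the fixed basis of the first
  factor).\<close>

definition block :: "nat \<Rightarrow> nat \<Rightarrow> complex mat \<Rightarrow> complex mat" where
  "block r x X = mat r r (\<lambda>(s, t). X $$ (x * r + s, x * r + t))"

definition ptrace_fst :: "nat \<Rightarrow> nat \<Rightarrow> complex mat \<Rightarrow> complex mat" where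
  "ptrace_fst N r X = mat_sum r (\<lambda>x. block r x X) {..<N}"

text \<open>The infimum over \<open>\<mu>\<close> is taken in the extended reals: it is \<open>\<infinity>\<close> for those \<open>\<sigma>\<close> for which no
  \<open>\<mu>\<close> is admissible. The minimum over \<open>\<sigma>\<close> is attained, so it is the infimum.\<close>

definition Hmin :: "nat \<Rightarrow> nat \<Rightarrow> complex mat \<Rightarrow> ereal" where
  "Hmin N r \<rho> = - (INF \<sigma>\<in>{\<sigma>. density r \<sigma>}.
     INF \<mu>\<in>{\<mu>::real. psd (N * r)
        (complex_of_real (2 powr \<mu>) \<cdot>\<^sub>m kron (1\<^sub>m N) \<sigma> - \<rho>)}. ereal \<mu>)"

text \<open>\<open>lab m m'\<close> is the index of the vector of the fixed basis of the \<open>N\<close>-dimensional space that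
  is labelled \<open>|mm'\<rangle>\<close>, for \<open>m < M\<close> and \<open>m' < Mc\<close>; any labelling is allowed.\<close>

definition tensor_labelling :: "nat \<Rightarrow> nat \<Rightarrow> nat \<Rightarrow> (nat \<Rightarrow> nat \<Rightarrow> nat) \<Rightarrow> bool" where
  "tensor_labelling N M Mc lab \<longleftrightarrow>
     bij_betw (\<lambda>(m, m'). lab m m') ({..<M} \<times> {..<Mc}) {..<N}"

text \<open>The measurement map on the first factor, tensored with the identity on an \<open>r\<close>-dimensional
  second factor.\<close>

definition meas_map ::
  "nat \<Rightarrow> nat \<Rightarrow> (nat \<Rightarrow> nat \<Rightarrow> nat) \<Rightarrow> nat \<Rightarrow> complex mat \<Rightarrow> complex mat" where
  "meas_map M Mc lab r X =
     mat_sum (M * r) (\<lambda>(m, m'). kron (basis_proj M m) (block r (lab m m') X))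
       ({..<M} \<times> {..<Mc})"

definition extractor_output ::
  "nat \<Rightarrow> nat \<Rightarrow> (nat \<Rightarrow> nat \<Rightarrow> nat) \<Rightarrow> nat \<Rightarrow> (nat \<Rightarrow> complex mat) \<Rightarrow> nat \<Rightarrow> complex mat
     \<Rightarrow> complex mat" where
  "extractor_output M Mc lab D V r \<rho> =
     (1 / of_nat D) \<cdot>\<^sub>m mat_sum (M * r * D)
       (\<lambda>i. kron
          (meas_map M Mc lab r (kron (V i) (1\<^sub>m r) * \<rho> * mat_adjoint (kron (V i) (1\<^sub>m r))))
          (basis_proj D i))
       {..<D}"

definition ideal_output :: "nat \<Rightarrow> nat \<Rightarrow> nat \<Rightarrow> nat \<Rightarrow> complex mat \<Rightarrow> complex mat" where
  "ideal_output N M D r \<rho> =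
     kron (kron ((1 / of_nat M) \<cdot>\<^sub>m 1\<^sub>m M) (ptrace_fst N r \<rho>)) ((1 / of_nat D) \<cdot>\<^sub>m 1\<^sub>m D)"

text \<open>The unitaries are \<open>V 0, \<dots>, V (D - 1)\<close>; as a family they may contain repetitions.\<close>

definition strong_qc_extractor ::
  "nat \<Rightarrow> nat \<Rightarrow> nat \<Rightarrow> (nat \<Rightarrow> nat \<Rightarrow> nat) \<Rightarrow> real \<Rightarrow> real \<Rightarrow> nat \<Rightarrow> (nat \<Rightarrow> complex mat)
     \<Rightarrow> bool" where
  "strong_qc_extractor N M Mc lab k \<epsilon> D V \<longleftrightarrow>
     tensor_labelling N M Mc lab \<and>
     - log 2 (real N) \<le> k \<and> k \<le> log 2 (real N) \<and> 0 < \<epsilon> \<and>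
     0 < D \<and> (\<forall>i<D. unitary_mat N (V i)) \<and>
     (\<forall>r \<rho>. density (N * r) \<rho> \<and> ereal k \<le> Hmin N r \<rho> \<longrightarrow>
        trace_norm (extractor_output M Mc lab D V r \<rho> - ideal_output N M D r \<rho>) \<le> \<epsilon>)"

definition onb :: "nat \<Rightarrow> (nat \<Rightarrow> complex vec) \<Rightarrow> bool" where
  "onb N b \<longleftrightarrow> (\<forall>k<N. b k \<in> carrier_vec N) \<and>
     (\<forall>k<N. \<forall>l<N. b k \<bullet>c b l = (if k = l then 1 else 0))"

definition mutually_unbiased ::
  "nat \<Rightarrow> (nat \<Rightarrow> complex vec) \<Rightarrow> (nat \<Rightarrow> complex vec) \<Rightarrow> bool" where
  "mutually_unbiased N b c \<longleftrightarrow> (\<forall>k<N. \<forall>l<N. cmod (b k \<bullet>c c l) = 1 / sqrt (real N))"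

text \<open>The bases are \<open>B 0, \<dots>, B N\<close>, and \<open>U \<theta>\<close> maps \<open>B \<theta>\<close> to the fixed basis.\<close>

definition full_mub ::
  "nat \<Rightarrow> (nat \<Rightarrow> nat \<Rightarrow> complex vec) \<Rightarrow> (nat \<Rightarrow> complex mat) \<Rightarrow> bool" where
  "full_mub N B U \<longleftrightarrow>
     (\<forall>\<theta><N+1. onb N (B \<theta>)) \<and>
     (\<forall>\<theta><N+1. \<forall>\<theta>'<N+1. \<theta> \<noteq> \<theta>' \<longrightarrow> mutually_unbiased N (B \<theta>) (B \<theta>')) \<and>
     (\<forall>\<theta><N+1. unitary_mat N (U \<theta>) \<and> (\<forall>k<N. U \<theta> *\<^sub>v B \<theta> k = unit_vec N k))"

text \<open>Nonemptiness is needed for the uniform distribution on \<open>P\<close> to exist (it does not follow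
  from the last condition if \<open>X\<close> has at most one element).\<close>

definition pairwise_independent :: "'a set \<Rightarrow> ('a \<Rightarrow> 'a) set \<Rightarrow> bool" where
  "pairwise_independent X P \<longleftrightarrow>
     finite P \<and> P \<noteq> {} \<and> (\<forall>\<pi>\<in>P. \<pi> permutes X) \<and>
     (\<forall>x1\<in>X. \<forall>x2\<in>X. \<forall>y1\<in>X. \<forall>y2\<in>X. x1 \<noteq> x2 \<longrightarrow> y1 \<noteq> y2 \<longrightarrow>
        real (card {\<pi> \<in> P. \<pi> x1 = y1 \<and> \<pi> x2 = y2}) / real (card P)
          = 1 / (real (card X) * (real (card X) - 1)))"

definition perm_op :: "nat \<Rightarrow> (nat \<Rightarrow> nat) \<Rightarrow> complex mat" where
  "perm_op N \<pi> = mat N N (\<lambda>(i, j). if i = \<pi> j then 1 else 0)"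

text \<open>The products \<open>P\<^sup>j U\<^sup>\<theta>\<close>, where the pair of \<open>j\<close> and \<open>\<theta> < N + 1\<close> is encoded as the single index
  \<open>j * (N + 1) + \<theta>\<close>.\<close>

definition perm_mub_unitary ::
  "nat \<Rightarrow> (nat \<Rightarrow> nat \<Rightarrow> nat) \<Rightarrow> (nat \<Rightarrow> complex mat) \<Rightarrow> nat \<Rightarrow> complex mat" where
  "perm_mub_unitary N P U i = perm_op N (P (i div (N + 1))) * U (i mod (N + 1))"

text \<open>The maps \<open>x \<mapsto> a x + b\<close> with \<open>a \<noteq> 0\<close> on a field, transported to \<open>{..<N}\<close> along a bijection
  \<open>enc\<close> from \<open>{..<N}\<close> to the field and extended by the identity.\<close>

definition affine_perms :: "nat \<Rightarrow> (nat \<Rightarrow> 'x::field) \<Rightarrow> (nat \<Rightarrow> nat) set" where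
  "affine_perms N enc =
     {(\<lambda>x. if x < N then inv_into {..<N} enc (a * enc x + b) else x) | a b. a \<noteq> 0}"

end

theory Submission
  imports Defs "HOL-Analysis.L2_Norm"
begin

text \<open>
  Let \<open>\<rho> \<le> 2\<^sup>\<mu> 1 \<otimes> \<sigma>\<close> with \<open>\<mu>\<close> close to \<open>-k\<close>, replace \<open>\<sigma>\<close> by the invertible \<open>\<sigma> + 1/r\<close> and factor it as
  \<open>L L\<^sup>\<dagger>\<close>. The error operator depends linearly on \<open>\<rho>\<close> and commutes with left multiplication on the
  side information, so writing \<open>\<rho> = (1 \<otimes> L) X\<close> and applying Hoelder's inequality bounds its trace
  norm by the Hilbert-Schmidt norms of \<open>1 \<otimes> L \<otimes> 1\<close> and of the error operator of \<open>X\<close>. This one-sided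
  weighting needs no fractional powers of \<open>\<sigma>\<close>, and \<open>X\<close> satisfies \<open>\<parallel>X\<parallel>\<^sup>2 \<le> 2\<^sup>\<mu>\<close>.

  For the error of \<open>X\<close>, one may fix an entry on the side information and consider an arbitrary
  operator on the input space. By pairwise independence the permutations only contribute a
  factor at most \<open>1\<close> to the sum over \<open>\<theta>\<close> and \<open>n\<close> of \<open>|\<langle>\<theta>\<^sub>n|X|\<theta>\<^sub>n\<rangle> - tr X / N|\<^sup>2\<close>, since the off-diagonal
  correlations are negative. As the traceless parts of the projections of unbiased bases are
  orthogonal for different bases, Bessel's inequality bounds that sum by \<open>\<parallel>X\<parallel>\<^sup>2\<close>, and averaging over
  the bases gains the factor \<open>1 / (N + 1)\<close>. The passage from \<open>\<sigma>\<close> to \<open>\<sigma> + 1/r\<close> and from the infimum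
  \<open>-k\<close> to \<open>\<mu> < 1 - k\<close> each cost a factor \<open>2\<close>, which the summand \<open>-2\<close> in the output size absorbs.
\<close>

section \<open>Bessel inequality and spectral theorem\<close>

lemma mult_mat_index:
  assumes "A \<in> carrier_mat n m" "B \<in> carrier_mat m p" "i < n" "j < p"
  shows "(A * B) $$ (i, j) = (\<Sum>k<m. A $$ (i, k) * B $$ (k, j))"
  using assms by (auto simp: scalar_prod_def atLeast0LessThan intro!: sum.cong)

lemma mult_mat_vec_index:
  assumes "A \<in> carrier_mat n m" "v \<in> carrier_vec m" "i < n"
  shows "(A *\<^sub>v v) $ i = (\<Sum>k<m. A $$ (i, k) * v $ k)"
  using assms by (auto simp: scalar_prod_def atLeast0LessThan intro!: sum.cong)

lemma cscalar_prod_index: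
  fixes v w :: "complex vec"
  assumes "v \<in> carrier_vec n" "w \<in> carrier_vec n"
  shows "v \<bullet>c w = (\<Sum>i<n. v $ i * cnj (w $ i))"
  using assms by (auto simp: scalar_prod_def atLeast0LessThan conjugate_complex_def intro!: sum.cong)

lemma mat_adjoint_index:
  fixes A :: "complex mat"
  assumes "i < dim_col A" "j < dim_row A"
  shows "mat_adjoint A $$ (i, j) = cnj (A $$ (j, i))"
  using assms by (simp add: mat_adjoint_def mat_of_rows_def conjugate_complex_def)

lemma mat_adjoint_carrier:
  "A \<in> carrier_mat n m \<Longrightarrow> mat_adjoint A \<in> carrier_mat m n"
  by (auto simp: mat_adjoint_def)

lemma mat_adjoint_dim [simp]:
  "dim_row (mat_adjoint A) = dim_col A" "dim_col (mat_adjoint A) = dim_row A"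
  by (auto simp: mat_adjoint_def)

lemma sum_mult_cnj:
  "(\<Sum>i\<in>I. f i * cnj (f i)) = complex_of_real (\<Sum>i\<in>I. (cmod (f i))\<^sup>2)"
  by (simp only: of_real_sum complex_norm_square)

text \<open>The hypothesis on \<open>c\<close> says that \<open>c\<close> is fixed by the Gram matrix of the vectors \<open>e k\<close>.
  This covers orthonormal families with some members replaced by zero, and also families that
  are orthonormal only modulo linear relations satisfied by \<open>c\<close>.\<close>

lemma bessel_gram:
  fixes x :: "'j \<Rightarrow> complex" and e :: "'i \<Rightarrow> 'j \<Rightarrow> complex"
  assumes fin: "finite I" "finite J"
    and c: "\<And>k. k \<in> I \<Longrightarrow> c k = (\<Sum>j\<in>J. x j * cnj (e k j))"
    and gram: "\<And>k. k \<in> I \<Longrightarrow> (\<Sum>l\<in>I. c l * (\<Sum>j\<in>J. e l j * cnj (e k j))) = c k"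
  shows "(\<Sum>k\<in>I. (cmod (c k))\<^sup>2) \<le> (\<Sum>j\<in>J. (cmod (x j))\<^sup>2)"
proof -
  \<comment> \<open>\<open>y\<close> combines the \<open>e k\<close> with coefficients
    \<open>c k\<close>, like a projection of \<open>x\<close>. The products \<open>yy\<close>,
    \<open>xy\<close> and \<open>yx\<close> all equal \<open>?Q\<close>, so the squared distance
    between \<open>x\<close> and \<open>y\<close> is the squared norm of \<open>x\<close> minus
    \<open>?Q\<close>; its nonnegativity is the claim.\<close>
  define y where "y j = (\<Sum>k\<in>I. c k * e k j)" for j
  let ?Q = "\<Sum>k\<in>I. (cmod (c k))\<^sup>2"
  have Q: "complex_of_real ?Q = (\<Sum>k\<in>I. c k * cnj (c k))"
    by (simp only: sum_mult_cnj)
  have "(\<Sum>j\<in>J. y j * cnj (y j)) = (\<Sum>j\<in>J. \<Sum>k\<in>I. \<Sum>l\<in>I. c l * e l j * (cnj (c k) * cnj (e k j)))"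
    by (simp add: y_def sum_distrib_left sum_distrib_right)
  also have "\<dots> = (\<Sum>k\<in>I. \<Sum>l\<in>I. \<Sum>j\<in>J. c l * e l j * (cnj (c k) * cnj (e k j)))"
    by (subst sum.swap) (intro sum.cong refl sum.swap)
  also have "\<dots> = (\<Sum>k\<in>I. cnj (c k) * (\<Sum>l\<in>I. c l * (\<Sum>j\<in>J. e l j * cnj (e k j))))"
    by (simp add: sum_distrib_left mult_ac)
  also have "\<dots> = complex_of_real ?Q"
    unfolding Q by (intro sum.cong refl) (simp add: gram)
  finally have yy: "(\<Sum>j\<in>J. y j * cnj (y j)) = complex_of_real ?Q" .
  have "(\<Sum>j\<in>J. x j * cnj (y j)) = (\<Sum>j\<in>J. \<Sum>k\<in>I. x j * cnj (e k j) * cnj (c k))"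
    by (simp add: y_def sum_distrib_left mult_ac)
  also have "\<dots> = (\<Sum>k\<in>I. (\<Sum>j\<in>J. x j * cnj (e k j)) * cnj (c k))"
    by (subst sum.swap) (simp add: sum_distrib_right)
  also have "\<dots> = complex_of_real ?Q"
    unfolding Q by (intro sum.cong refl) (simp add: c)
  finally have xy: "(\<Sum>j\<in>J. x j * cnj (y j)) = complex_of_real ?Q" .
  have "(\<Sum>j\<in>J. y j * cnj (x j)) = cnj (\<Sum>j\<in>J. x j * cnj (y j))"
    by (simp add: mult_ac)
  then have yx: "(\<Sum>j\<in>J. y j * cnj (x j)) = complex_of_real ?Q"
    unfolding xy by simp
  have "complex_of_real (\<Sum>j\<in>J. (cmod (x j - y j))\<^sup>2) = (\<Sum>j\<in>J. (x j - y j) * cnj (x j - y j))"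
    by (simp only: sum_mult_cnj)
  also have "\<dots> = (\<Sum>j\<in>J. x j * cnj (x j)) - (\<Sum>j\<in>J. x j * cnj (y j))
      - (\<Sum>j\<in>J. y j * cnj (x j)) + (\<Sum>j\<in>J. y j * cnj (y j))"
    by (simp add: algebra_simps sum.distrib sum_subtractf)
  also have "\<dots> = complex_of_real ((\<Sum>j\<in>J. (cmod (x j))\<^sup>2) - ?Q)"
    unfolding xy yx yy unfolding sum_mult_cnj by simp
  finally have "(\<Sum>j\<in>J. (cmod (x j - y j))\<^sup>2) = (\<Sum>j\<in>J. (cmod (x j))\<^sup>2) - ?Q"
    unfolding of_real_eq_iff .
  moreover have "0 \<le> (\<Sum>j\<in>J. (cmod (x j - y j))\<^sup>2)" by (intro sum_nonneg) auto
  ultimately show ?thesis by simp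
qed

lemma cauchy_schwarz_complex_sum:
  fixes a b :: "'i \<Rightarrow> complex"
  shows "cmod (\<Sum>i\<in>I. a i * b i) \<le> sqrt (\<Sum>i\<in>I. (cmod (a i))\<^sup>2) * sqrt (\<Sum>i\<in>I. (cmod (b i))\<^sup>2)"
proof -
  have "cmod (\<Sum>i\<in>I. a i * b i) \<le> (\<Sum>i\<in>I. \<bar>cmod (a i)\<bar> * \<bar>cmod (b i)\<bar>)"
    by (rule order_trans[OF norm_sum]) (simp add: norm_mult)
  also have "\<dots> \<le> L2_set (\<lambda>i. cmod (a i)) I * L2_set (\<lambda>i. cmod (b i)) I"
    by (rule L2_set_mult_ineq)
  finally show ?thesis by (simp add: L2_set_def)
qed

section \<open>Spectral theorem for Hermitian matrices\<close>

definition hermitian :: "nat \<Rightarrow> complex mat \<Rightarrow> bool" where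
  "hermitian n A \<longleftrightarrow> A \<in> carrier_mat n n \<and> (\<forall>i<n. \<forall>j<n. A $$ (i, j) = cnj (A $$ (j, i)))"

definition orthonormal :: "nat \<Rightarrow> nat \<Rightarrow> (nat \<Rightarrow> nat \<Rightarrow> complex) \<Rightarrow> bool" where
  "orthonormal n k w \<longleftrightarrow>
     (\<forall>a<k. \<forall>b<k. (\<Sum>i<n. w a i * cnj (w b i)) = (if a = b then 1 else 0))"

text \<open>Partial for \<open>k < n\<close>, so that eigenvectors can be added one at a time.
  Real-valued \<open>l\<close> makes each extension prove that the new eigenvalue is real.\<close>

definition eigensystem :: "nat \<Rightarrow> nat \<Rightarrow> complex mat \<Rightarrow> (nat \<Rightarrow> nat \<Rightarrow> complex) \<Rightarrow> (nat \<Rightarrow> real) \<Rightarrow> bool" where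
  "eigensystem n k A w l \<longleftrightarrow> orthonormal n k w \<and>
     (\<forall>a<k. \<forall>i<n. (\<Sum>j<n. A $$ (i, j) * w a j) = of_real (l a) * w a i)"

text \<open>The Schur form has the trace of \<open>A\<close> and carries the eigenvalues of
  \<open>A\<close> on its diagonal. If all of them were \<open>c\<close>, the trace would be
  \<open>n * c\<close>.\<close>

lemma eigenvalue_neq_exists:
  fixes A :: "complex mat"
  assumes A: "A \<in> carrier_mat n n" and tr: "mat_trace A \<noteq> of_nat n * c"
  obtains e v where "e \<noteq> c" "eigenvector A v e"
proof -
  obtain es where es: "char_poly A = (\<Prod>a\<leftarrow>es. [:- a, 1:])"
    using char_poly_factorized[OF A] by auto
  obtain T P Q where T: "schur_decomposition A es = (T, P, Q)" by (metis prod_cases3)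
  from schur_decomposition[OF A es T]
  have sim: "similar_mat_wit A T P Q" and d: "diag_mat T = es" by auto
  from similar_mat_witD2[OF A sim] have
    PQ: "P * Q = 1\<^sub>m n" "Q * P = 1\<^sub>m n" and APTQ: "A = P * T * Q"
    and carr: "T \<in> carrier_mat n n" "P \<in> carrier_mat n n" "Q \<in> carrier_mat n n" by auto
  have comm: "mat_trace (X * Y) = mat_trace (Y * X)"
    if "X \<in> carrier_mat n n" "Y \<in> carrier_mat n n" for X Y
  proof -
    have "mat_trace (X * Y) = (\<Sum>i<n. \<Sum>k<n. X $$ (i, k) * Y $$ (k, i))"
      using that by (simp add: mat_trace_def mult_mat_index[OF that] del: index_mult_mat(1))
    also have "\<dots> = (\<Sum>k<n. \<Sum>i<n. Y $$ (k, i) * X $$ (i, k))"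
      by (subst sum.swap) (simp add: mult_ac)
    also have "\<dots> = mat_trace (Y * X)"
      using that by (simp add: mat_trace_def mult_mat_index[OF that(2,1)] del: index_mult_mat(1))
    finally show ?thesis .
  qed
  have "mat_trace A = mat_trace (Q * (P * T))"
    unfolding APTQ using carr by (intro comm) auto
  also have "Q * (P * T) = T"
    using carr PQ by (metis assoc_mult_mat left_mult_one_mat)
  finally have trT: "mat_trace A = (\<Sum>i<n. T $$ (i, i))"
    using carr by (simp add: mat_trace_def)
  have "\<exists>i<n. T $$ (i, i) \<noteq> c"
  proof (rule ccontr)
    assume "\<not> ?thesis"
    then have "(\<Sum>i<n. T $$ (i, i)) = (\<Sum>i<n. c)" by (intro sum.cong) auto
    then show False using trT tr by simp
  qed
  then obtain i where i: "i < n" "T $$ (i, i) \<noteq> c" by auto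
  have "T $$ (i, i) \<in> set es"
    unfolding d[symmetric] diag_mat_def using i carr by auto
  then have "poly (char_poly A) (T $$ (i, i)) = 0"
    unfolding es by (auto simp: poly_prod_list prod_list_zero_iff)
  then have "eigenvalue A (T $$ (i, i))" using eigenvalue_root_char_poly[OF A] by simp
  then show ?thesis using that i unfolding eigenvalue_def by blast
qed

text \<open>Adding multiples of the projections on the known eigenvectors moves their eigenvalues to
  one value \<open>c\<close>. An eigenvector of the shifted matrix for a different eigenvalue is
  orthogonal to them, so the added part annihilates it and it is an eigenvector of \<open>A\<close>
  too.\<close>

lemma eigensystem_extend:
  assumes A: "hermitian n A" and k: "k < n" and w: "eigensystem n k A w l"
  obtains w' l' where "eigensystem n (Suc k) A w' l'"
proof -
  have Ac: "A \<in> carrier_mat n n" and Ah: "\<And>i j. i < n \<Longrightarrow> j < n \<Longrightarrow> cnj (A $$ (j, i)) = A $$ (i, j)"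
    using A unfolding hermitian_def by (blast, metis)
  have on: "\<And>a b. a < k \<Longrightarrow> b < k \<Longrightarrow> (\<Sum>i<n. w a i * cnj (w b i)) = (if a = b then 1 else 0)"
    and ev: "\<And>a i. a < k \<Longrightarrow> i < n \<Longrightarrow> (\<Sum>j<n. A $$ (i, j) * w a j) = of_real (l a) * w a i"
    using w unfolding eigensystem_def orthonormal_def by auto
  text \<open>Shifting the eigenvalues of the vectors found so far to a common \<open>c\<close> that the trace
    shows not to be the only eigenvalue.\<close>
  define c :: real where
    "c = (if mat_trace A = (\<Sum>a<k. of_real (l a)) then 1 else 0)"
  define A' where
    "A' = mat n n (\<lambda>(i, j). A $$ (i, j) + (\<Sum>a<k. of_real (c - l a) * w a i * cnj (w a j)))"
  have A'c: "A' \<in> carrier_mat n n" by (simp add: A'_def)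
  have A'h: "cnj (A' $$ (j, i)) = A' $$ (i, j)" if "i < n" "j < n" for i j
    using that Ah by (simp add: A'_def mult_ac)
  have "mat_trace A' = mat_trace A + (\<Sum>i<n. \<Sum>a<k. of_real (c - l a) * w a i * cnj (w a i))"
    using Ac by (simp add: mat_trace_def A'_def sum.distrib)
  also have "(\<Sum>i<n. \<Sum>a<k. of_real (c - l a) * w a i * cnj (w a i))
      = (\<Sum>a<k. of_real (c - l a) * (\<Sum>i<n. w a i * cnj (w a i)))"
    by (subst sum.swap) (simp add: sum_distrib_left mult_ac)
  also have "\<dots> = (\<Sum>a<k. of_real (c - l a))"
    by (intro sum.cong) (auto simp: on)
  finally have tr: "mat_trace A' = mat_trace A - (\<Sum>a<k. of_real (l a)) + of_nat k * of_real c"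
    by (simp add: sum_subtractf)
  \<comment> \<open>The two sides differ by \<open>mat_trace A - (\<Sum>a<k. of_real (l a))\<close>
    minus \<open>(n - k) * c\<close>. The choice of \<open>c\<close> makes exactly one of these two
    terms nonzero.\<close>
  have "mat_trace A' \<noteq> of_nat n * of_real c"
  proof (cases "mat_trace A = (\<Sum>a<k. of_real (l a))")
    case True
    then show ?thesis using k by (simp add: tr c_def)
  next
    case False
    then show ?thesis by (simp add: tr c_def)
  qed
  then obtain e v where e: "e \<noteq> of_real c" and v: "eigenvector A' v e"
    using eigenvalue_neq_exists[OF A'c] by metis
  have vc: "v \<in> carrier_vec n" and v0: "v \<noteq> 0\<^sub>v n" and ve: "A' *\<^sub>v v = e \<cdot>\<^sub>v v"
    using v A'c unfolding eigenvector_def by auto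
  have A'v: "(\<Sum>j<n. A' $$ (i, j) * v $ j) = e * v $ i" if "i < n" for i
    using arg_cong[OF ve, of "\<lambda>u. u $ i"] mult_mat_vec_index[OF A'c vc that] vc that by simp
  have A'w: "(\<Sum>j<n. A' $$ (i, j) * w a j) = of_real c * w a i" if a: "a < k" and i: "i < n" for a i
  proof -
    have "(\<Sum>j<n. A' $$ (i, j) * w a j) = (\<Sum>j<n. A $$ (i, j) * w a j)
       + (\<Sum>j<n. \<Sum>b<k. of_real (c - l b) * w b i * cnj (w b j) * w a j)"
      using i by (simp add: A'_def sum.distrib algebra_simps sum_distrib_left sum_distrib_right)
    also have "(\<Sum>j<n. \<Sum>b<k. of_real (c - l b) * w b i * cnj (w b j) * w a j)
       = (\<Sum>b<k. of_real (c - l b) * w b i * (\<Sum>j<n. w a j * cnj (w b j)))"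
      by (subst sum.swap) (simp add: sum_distrib_left mult_ac)
    also have "\<dots> = (\<Sum>b<k. if b = a then of_real (c - l a) * w a i else 0)"
      by (intro sum.cong) (auto simp: on a)
    also have "\<dots> = of_real (c - l a) * w a i" using a by simp
    finally show ?thesis using ev[OF a i] by (simp add: algebra_simps)
  qed
  \<comment> \<open>Self-adjointness of \<open>A'\<close>, used twice: against a known eigenvector
    it gives orthogonality, and against \<open>v\<close> itself it gives that \<open>e\<close> is
    real.\<close>
  have adj: "(\<Sum>i<n. (\<Sum>j<n. A' $$ (i, j) * x j) * cnj (y i)) = (\<Sum>j<n. x j * cnj (\<Sum>i<n. A' $$ (j, i) * y i))"
    for x y :: "nat \<Rightarrow> complex"
  proof -
    have "(\<Sum>i<n. (\<Sum>j<n. A' $$ (i, j) * x j) * cnj (y i)) = (\<Sum>j<n. \<Sum>i<n. A' $$ (i, j) * x j * cnj (y i))"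
      by (subst sum.swap) (simp add: sum_distrib_right)
    also have "\<dots> = (\<Sum>j<n. x j * cnj (\<Sum>i<n. A' $$ (j, i) * y i))"
      by (intro sum.cong refl) (auto simp: sum_distrib_left A'h intro!: sum.cong)
    finally show ?thesis .
  qed
  have vw: "(\<Sum>i<n. v $ i * cnj (w a i)) = 0" if a: "a < k" for a
  proof -
    have "e * (\<Sum>i<n. v $ i * cnj (w a i)) = (\<Sum>i<n. (\<Sum>j<n. A' $$ (i, j) * v $ j) * cnj (w a i))"
      unfolding sum_distrib_left by (intro sum.cong refl) (simp add: A'v)
    also have "\<dots> = of_real c * (\<Sum>i<n. v $ i * cnj (w a i))"
      unfolding adj sum_distrib_left by (intro sum.cong refl) (simp add: A'w[OF a])
    finally show ?thesis using e by simp
  qed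
  define q where "q = (\<Sum>i<n. (cmod (v $ i))\<^sup>2)"
  have q: "(\<Sum>i<n. v $ i * cnj (v $ i)) = of_real q"
    by (simp only: q_def sum_mult_cnj)
  have "\<exists>i<n. v $ i \<noteq> 0" using v0 vc by (metis carrier_vecD eq_vecI index_zero_vec(1,2))
  then have qpos: "q > 0" unfolding q_def by (auto intro!: sum_pos2)
  have "e * of_real q = (\<Sum>i<n. (\<Sum>j<n. A' $$ (i, j) * v $ j) * cnj (v $ i))"
    unfolding q[symmetric] sum_distrib_left by (intro sum.cong refl) (simp add: A'v)
  also have "\<dots> = cnj e * of_real q"
    unfolding adj q[symmetric] sum_distrib_left by (intro sum.cong refl) (simp add: A'v)
  finally have "cnj e = e" using qpos by simp
  then have er: "e = of_real (Re e)" by (simp add: complex_eq_iff)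
  have Av: "(\<Sum>j<n. A $$ (i, j) * v $ j) = e * v $ i" if i: "i < n" for i
  proof -
    have "e * v $ i = (\<Sum>j<n. A $$ (i, j) * v $ j)
       + (\<Sum>j<n. \<Sum>b<k. of_real (c - l b) * w b i * cnj (w b j) * v $ j)"
      using i unfolding A'v[OF i, symmetric]
      by (simp add: A'_def sum.distrib algebra_simps sum_distrib_left sum_distrib_right)
    also have "(\<Sum>j<n. \<Sum>b<k. of_real (c - l b) * w b i * cnj (w b j) * v $ j)
       = (\<Sum>b<k. of_real (c - l b) * w b i * (\<Sum>j<n. v $ j * cnj (w b j)))"
      by (subst sum.swap) (simp add: sum_distrib_left mult_ac)
    also have "\<dots> = 0" by (intro sum.neutral) (auto simp: vw)
    finally show ?thesis by simp
  qed
  define s where "s = complex_of_real (sqrt q)"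
  have s: "s * s = of_real q" "cnj s = s"
    using qpos by (auto simp: s_def simp flip: of_real_mult)
  define u where "u i = v $ i / s" for i
  have uu: "(\<Sum>i<n. u i * cnj (u i)) = 1"
  proof -
    have "(\<Sum>i<n. u i * cnj (u i)) = (\<Sum>i<n. v $ i * cnj (v $ i)) / (s * s)"
      unfolding u_def sum_divide_distrib by (simp add: s(2))
    also have "\<dots> = 1" unfolding q s using qpos by simp
    finally show ?thesis .
  qed
  have uw: "(\<Sum>i<n. u i * cnj (w a i)) = 0" if "a < k" for a
    using vw[OF that] by (simp add: u_def sum_divide_distrib[symmetric])
  have wu: "(\<Sum>i<n. w a i * cnj (u i)) = 0" if "a < k" for a
    using arg_cong[OF uw[OF that], of cnj] by (simp add: mult_ac)
  have Au: "(\<Sum>j<n. A $$ (i, j) * u j) = of_real (Re e) * u i" if i: "i < n" for i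
    using Av[OF i] er by (simp add: u_def sum_divide_distrib[symmetric])
  have "eigensystem n (Suc k) A (w(k := u)) (l(k := Re e))"
    unfolding eigensystem_def orthonormal_def
    using on ev uu uw wu Au by (auto simp: less_Suc_eq)
  then show ?thesis by (rule that)
qed

lemma hermitian_eigensystem:
  assumes "hermitian n A"
  obtains w l where "eigensystem n n A w l"
proof -
  have "\<exists>w l. eigensystem n k A w l" if "k \<le> n" for k
    using that
  proof (induction k)
    case 0
    show ?case by (simp add: eigensystem_def orthonormal_def)
  next
    case (Suc k)
    then show ?case using eigensystem_extend[OF assms, of k] by (metis Suc_le_eq less_imp_le_nat)
  qed
  then show ?thesis using that by blast
qed

text \<open>The square matrix with columns \<open>w k\<close> has its adjoint as a left inverse,
  hence also as a right inverse; the latter is the completeness relation.\<close>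

lemma orthonormal_complete:
  assumes "orthonormal n n w" "i < n" "j < n"
  shows "(\<Sum>k<n. w k i * cnj (w k j)) = (if i = j then 1 else 0)"
proof -
  define W where "W = mat n n (\<lambda>(i, k). w k i)"
  define V where "V = mat n n (\<lambda>(k, i). cnj (w k i))"
  have c: "W \<in> carrier_mat n n" "V \<in> carrier_mat n n" by (auto simp: W_def V_def)
  have "V * W = 1\<^sub>m n"
  proof (intro eq_matI)
    fix k l assume "k < dim_row (1\<^sub>m n)" "l < dim_col (1\<^sub>m n)"
    then have kl: "k < n" "l < n" by auto
    have "(\<Sum>i<n. cnj (w k i) * w l i) = (if l = k then 1 else 0)"
      using assms(1) kl unfolding orthonormal_def by (simp add: mult.commute)
    then show "(V * W) $$ (k, l) = 1\<^sub>m n $$ (k, l)"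
      using kl mult_mat_index[OF c(2,1) kl] by (simp add: V_def W_def)
  qed (use c in auto)
  then have "W * V = 1\<^sub>m n" using mat_mult_left_right_inverse c by blast
  then show ?thesis using mult_mat_index[OF c assms(2,3)] assms(2,3) by (simp add: W_def V_def)
qed

lemma eigensystem_expand:
  assumes A: "A \<in> carrier_mat n n" and w: "eigensystem n n A w l" and ij: "i < n" "j < n"
  shows "A $$ (i, j) = (\<Sum>k<n. of_real (l k) * w k i * cnj (w k j))"
proof -
  have on: "orthonormal n n w" using w by (simp add: eigensystem_def)
  have "A $$ (i, j) = (\<Sum>a<n. A $$ (i, a) * (if a = j then 1 else 0))"
    using ij by (simp add: if_distrib cong: if_cong)
  also have "\<dots> = (\<Sum>a<n. A $$ (i, a) * (\<Sum>k<n. w k a * cnj (w k j)))"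
    by (intro sum.cong refl) (use on ij orthonormal_complete in auto)
  also have "\<dots> = (\<Sum>k<n. (\<Sum>a<n. A $$ (i, a) * w k a) * cnj (w k j))"
    unfolding sum_distrib_left sum_distrib_right by (subst sum.swap) (simp add: mult_ac)
  also have "\<dots> = (\<Sum>k<n. of_real (l k) * w k i * cnj (w k j))"
    using w ij by (intro sum.cong refl) (auto simp: eigensystem_def)
  finally show ?thesis .
qed

section \<open>Positive semidefinite matrices and the trace norm\<close>

text \<open>Complex-valued, because the order used in \<open>psd\<close> also asserts that the form
  is real. The argument is a function instead of a vector, which spares carrier conditions.\<close>

definition quad :: "nat \<Rightarrow> complex mat \<Rightarrow> (nat \<Rightarrow> complex) \<Rightarrow> complex" where
  "quad n A x = (\<Sum>i<n. (\<Sum>j<n. A $$ (i, j) * x j) * cnj (x i))"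

lemma quad_eq_cscalar_prod:
  assumes "A \<in> carrier_mat n n" "v \<in> carrier_vec n"
  shows "(A *\<^sub>v v) \<bullet>c v = quad n A (\<lambda>i. v $ i)"
  using assms
  by (subst cscalar_prod_index[of _ n])
     (auto simp: quad_def mult_mat_vec_index[OF assms] simp del: index_mult_mat_vec intro!: sum.cong)

lemma psd_iff_quad:
  "psd n A \<longleftrightarrow> A \<in> carrier_mat n n \<and> (\<forall>x. 0 \<le> quad n A x)"
proof (intro iffI conjI allI)
  fix x
  assume A: "psd n A"
  have "quad n A x = quad n A (\<lambda>i. vec n x $ i)"
    by (auto simp: quad_def intro!: sum.cong)
  also have "\<dots> = (A *\<^sub>v vec n x) \<bullet>c vec n x"
    using A by (intro quad_eq_cscalar_prod[symmetric]) (auto simp: psd_def)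
  finally show "0 \<le> quad n A x" using A by (auto simp: psd_def)
qed (auto simp: psd_def quad_eq_cscalar_prod)

lemma quad_gram:
  assumes "\<And>i j. i < n \<Longrightarrow> j < n \<Longrightarrow> A $$ (i, j) = (\<Sum>k\<in>I. y k i * cnj (y k j))"
  shows "quad n A x = of_real (\<Sum>k\<in>I. (cmod (\<Sum>j<n. cnj (y k j) * x j))\<^sup>2)"
proof -
  have "quad n A x = (\<Sum>i<n. \<Sum>j<n. \<Sum>k\<in>I. y k i * cnj (y k j) * x j * cnj (x i))"
    unfolding quad_def by (intro sum.cong refl) (simp add: assms sum_distrib_right)
  also have "\<dots> = (\<Sum>i<n. \<Sum>k\<in>I. \<Sum>j<n. y k i * cnj (y k j) * x j * cnj (x i))"
    by (intro sum.cong refl sum.swap)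
  also have "\<dots> = (\<Sum>k\<in>I. \<Sum>i<n. \<Sum>j<n. y k i * cnj (y k j) * x j * cnj (x i))"
    by (rule sum.swap)
  also have "\<dots> = (\<Sum>k\<in>I. (\<Sum>j<n. cnj (y k j) * x j) * cnj (\<Sum>j<n. cnj (y k j) * x j))"
    by (simp add: sum_product mult_ac) (subst sum.swap, simp add: mult_ac)
  finally show ?thesis by (simp only: sum_mult_cnj)
qed

lemma psd_gram:
  assumes "A \<in> carrier_mat n n"
    and "\<And>i j. i < n \<Longrightarrow> j < n \<Longrightarrow> A $$ (i, j) = (\<Sum>k\<in>I. y k i * cnj (y k j))"
  shows "psd n A"
  unfolding psd_iff_quad using assms quad_gram[of n A y I]
  by (auto simp: less_eq_complex_def intro!: sum_nonneg)

text \<open>Polarisation: the form is real at every vector, in particular at those supported on two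
  coordinates.\<close>

lemma psd_hermitian:
  assumes "psd n A"
  shows "hermitian n A"
  unfolding hermitian_def
proof (intro conjI allI impI)
  show "A \<in> carrier_mat n n" using assms by (simp add: psd_def)
  fix i j assume ij: "i < n" "j < n"
  \<comment> \<open>Adding two conditionals, instead of nesting them, keeps the formula valid for
    \<open>a = b\<close>, which the diagonal case \<open>d\<close> relies on.\<close>
  have two: "(\<Sum>k<n. f k * ((if k = a then p else 0) + (if k = b then q else 0))) = f a * p + f b * q"
    if "a < n" "b < n" for f :: "nat \<Rightarrow> complex" and a b p q
  proof -
    have "(\<Sum>k<n. f k * ((if k = a then p else 0) + (if k = b then q else 0)))
        = (\<Sum>k<n. (if k = a then f a * p else 0) + (if k = b then f b * q else 0))"
      by (intro sum.cong) (auto simp: distrib_left)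
    then show ?thesis using that by (simp add: sum.distrib)
  qed
  have q: "quad n A (\<lambda>k. (if k = a then p else 0) + (if k = b then z else 0)) =
     (A $$ (a, a) * p + A $$ (a, b) * z) * cnj p + (A $$ (b, a) * p + A $$ (b, b) * z) * cnj z"
    if "a < n" "b < n" for a b p z
  proof -
    have "cnj ((if k = a then p else 0) + (if k = b then z else 0))
       = (if k = a then cnj p else 0) + (if k = b then cnj z else 0)" for k by simp
    then show ?thesis unfolding quad_def by (simp add: two that del: complex_cnj_add)
  qed
  have im: "Im (quad n A x) = 0" for x
    using assms by (auto simp: psd_iff_quad less_eq_complex_def)
  have d: "Im (A $$ (a, a)) = 0" if "a < n" for a
    using im[of "\<lambda>k. (if k = a then 1 else 0) + (if k = a then 0 else 0)"] q[OF that that, of 1 0]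
    by simp
  \<comment> \<open>Coefficients \<open>1, 1\<close> compare the imaginary parts of the two entries,
    coefficients \<open>1, \<i>\<close> their real parts.\<close>
  have "Im (A $$ (i, j)) = - Im (A $$ (j, i))"
    using im[of "\<lambda>k. (if k = i then 1 else 0) + (if k = j then 1 else 0)"] q[OF ij, of 1 1] d ij
    by simp
  moreover have "Re (A $$ (i, j)) = Re (A $$ (j, i))"
    using im[of "\<lambda>k. (if k = i then 1 else 0) + (if k = j then \<i> else 0)"] q[OF ij, of 1 \<i>] d ij
    by simp
  ultimately show "A $$ (i, j) = cnj (A $$ (j, i))" by (simp add: complex_eq_iff)
qed

lemma psd_eigensystem:
  assumes "psd n A"
  obtains w l where "eigensystem n n A w l" "\<And>k. k < n \<Longrightarrow> 0 \<le> l k"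
proof -
  obtain w l where w: "eigensystem n n A w l"
    using hermitian_eigensystem[OF psd_hermitian[OF assms]] by blast
  have "0 \<le> l k" if k: "k < n" for k
  proof -
    have "quad n A (w k) = (\<Sum>i<n. of_real (l k) * (w k i * cnj (w k i)))"
      unfolding quad_def using w k by (intro sum.cong refl) (simp add: eigensystem_def)
    also have "\<dots> = of_real (l k)"
      using w k by (simp add: sum_distrib_left[symmetric] eigensystem_def orthonormal_def)
    finally have "quad n A (w k) = of_real (l k)" .
    moreover have "0 \<le> quad n A (w k)" using assms by (simp add: psd_iff_quad)
    ultimately show ?thesis by (simp add: less_eq_complex_def)
  qed
  then show ?thesis using that w by blast
qed

text \<open>Scaling the eigenvectors by the roots of their nonnegative eigenvalues absorbs the
  eigenvalues.\<close>

lemma psd_gramE: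
  assumes "psd n A"
  obtains y where "\<And>i j. i < n \<Longrightarrow> j < n \<Longrightarrow> A $$ (i, j) = (\<Sum>k<n. y k i * cnj (y k j))"
proof -
  obtain w l where w: "eigensystem n n A w l" and l: "\<And>k. k < n \<Longrightarrow> 0 \<le> l k"
    using psd_eigensystem[OF assms] by blast
  have A: "A \<in> carrier_mat n n" using assms by (simp add: psd_def)
  have "A $$ (i, j) = (\<Sum>k<n. (of_real (sqrt (l k)) * w k i) * cnj (of_real (sqrt (l k)) * w k j))"
    if "i < n" "j < n" for i j
    unfolding eigensystem_expand[OF A w that]
  proof (intro sum.cong refl)
    fix k assume "k \<in> {..<n}"
    then have "complex_of_real (l k) = of_real (sqrt (l k)) * of_real (sqrt (l k))"
      using l[of k] by (simp flip: of_real_mult)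
    then show "of_real (l k) * w k i * cnj (w k j)
        = (of_real (sqrt (l k)) * w k i) * cnj (of_real (sqrt (l k)) * w k j)" by simp
  qed
  then show ?thesis by (rule that)
qed

text \<open>Ensures that the choice in \<open>psd_sqrt\<close> has something to choose: the root has
  the same eigenvectors and the roots of the eigenvalues.\<close>

lemma psd_sqrt_exists:
  assumes "psd n A"
  shows "\<exists>S. psd n S \<and> S * S = A"
proof -
  obtain w l where w: "eigensystem n n A w l" and l: "\<And>k. k < n \<Longrightarrow> 0 \<le> l k"
    using psd_eigensystem[OF assms] by blast
  have A: "A \<in> carrier_mat n n" using assms by (simp add: psd_def)
  have on: "(\<Sum>i<n. cnj (w k i) * w m i) = (if k = m then 1 else 0)" if "k < n" "m < n" for k m
    using w that by (auto simp: eigensystem_def orthonormal_def mult.commute[of "cnj _"])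
  define s where "s k = complex_of_real (sqrt (l k))" for k
  have ss: "s k * s k = of_real (l k)" if "k < n" for k
    using l[OF that] by (simp add: s_def flip: of_real_mult)
  define S where "S = mat n n (\<lambda>(i, j). \<Sum>k<n. s k * w k i * cnj (w k j))"
  have S: "S \<in> carrier_mat n n" by (simp add: S_def)
  \<comment> \<open>Scaling the eigenvectors by fourth roots of the eigenvalues exhibits
    \<open>S\<close> as a Gram matrix.\<close>
  have "psd n S"
  proof (rule psd_gram[OF S])
    fix i j assume "i < n" "j < n"
    then show "S $$ (i, j) = (\<Sum>k<n. (of_real (sqrt (sqrt (l k))) * w k i) * cnj (of_real (sqrt (sqrt (l k))) * w k j))"
    proof (simp add: S_def, intro sum.cong refl)
      fix k assume "k \<in> {..<n}"
      then have "s k = of_real (sqrt (sqrt (l k))) * of_real (sqrt (sqrt (l k)))"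
        using l[of k] by (simp add: s_def flip: of_real_mult)
      then show "s k * w k i * cnj (w k j)
        = of_real (sqrt (sqrt (l k))) * w k i * (of_real (sqrt (sqrt (l k))) * cnj (w k j))" by simp
    qed
  qed
  moreover have "S * S = A"
  proof (intro eq_matI)
    fix i j assume "i < dim_row A" "j < dim_col A"
    then have ij: "i < n" "j < n" using A by auto
    have "(S * S) $$ (i, j) = (\<Sum>a<n. \<Sum>k<n. \<Sum>m<n. s k * w k i * cnj (w k a) * (s m * w m a * cnj (w m j)))"
      using ij mult_mat_index[OF S S ij] by (simp add: S_def sum_product)
    also have "\<dots> = (\<Sum>k<n. \<Sum>a<n. \<Sum>m<n. s k * w k i * cnj (w k a) * (s m * w m a * cnj (w m j)))"
      by (rule sum.swap)
    also have "\<dots> = (\<Sum>k<n. \<Sum>m<n. \<Sum>a<n. s k * w k i * cnj (w k a) * (s m * w m a * cnj (w m j)))"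
      by (intro sum.cong refl sum.swap)
    also have "\<dots> = (\<Sum>k<n. \<Sum>m<n. s k * w k i * s m * cnj (w m j) * (\<Sum>a<n. cnj (w k a) * w m a))"
      by (simp add: sum_distrib_left mult_ac)
    also have "\<dots> = (\<Sum>k<n. \<Sum>m<n. if m = k then s k * w k i * s k * cnj (w k j) else 0)"
      by (intro sum.cong refl) (auto simp: on)
    also have "\<dots> = (\<Sum>k<n. (s k * s k) * w k i * cnj (w k j))" by (simp add: mult_ac)
    also have "\<dots> = A $$ (i, j)"
      unfolding eigensystem_expand[OF A w ij] by (intro sum.cong refl) (simp add: ss)
    finally show "(S * S) $$ (i, j) = A $$ (i, j)" .
  qed (use A S in auto)
  ultimately show ?thesis by blast
qed

lemma psd_sqrt:
  assumes "psd n A"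
  shows "psd n (psd_sqrt n A)" "psd_sqrt n A * psd_sqrt n A = A"
  using someI_ex[OF psd_sqrt_exists[OF assms]] unfolding psd_sqrt_def by auto

section \<open>Hilbert-Schmidt norm and Hoelder's inequality\<close>

definition frob_sq :: "complex mat \<Rightarrow> real" where
  "frob_sq A = (\<Sum>i<dim_row A. \<Sum>j<dim_col A. (cmod (A $$ (i, j)))\<^sup>2)"

text \<open>The trace norm is the sum of the singular values \<open>t k\<close>, and each is the
  inner product of the image of a right singular vector with a left singular vector. Moving
  \<open>K\<close> to the left vectors and keeping \<open>B\<close> on the right ones,
  Cauchy-Schwarz over all pairs \<open>(k, j)\<close> and a Bessel inequality for each family give
  the product of Hilbert-Schmidt norms.\<close>

lemma trace_norm_mult_le:
  assumes K: "K \<in> carrier_mat n n" and B: "B \<in> carrier_mat n n"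
  shows "trace_norm (K * B) \<le> sqrt (frob_sq K) * sqrt (frob_sq B)"
proof -
  define A where "A = K * B"
  have A: "A \<in> carrier_mat n n" using K B by (auto simp: A_def)
  define G where "G = mat_adjoint A * A"
  note A' = mat_adjoint_carrier[OF A]
  have G: "G \<in> carrier_mat n n" using A A' by (auto simp: G_def)
  have G_ij: "G $$ (i, j) = (\<Sum>a<n. cnj (A $$ (a, i)) * A $$ (a, j))" if "i < n" "j < n" for i j
    unfolding G_def mult_mat_index[OF A' A that] using that A
    by (intro sum.cong refl) (simp add: mat_adjoint_index)
  have "psd n G"
    by (rule psd_gram[OF G, where y = "\<lambda>a i. cnj (A $$ (a, i))" and I = "{..<n}"]) (simp add: G_ij)
  \<comment> \<open>\<open>T\<close> is the absolute value of \<open>A\<close>. Its eigenvectors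
    \<open>w k\<close> are right singular vectors of \<open>A\<close>, its eigenvalues
    \<open>t k\<close> are the singular values, and its trace is the trace norm.\<close>
  define T where "T = psd_sqrt n G"
  have psdT: "psd n T" and TT: "T * T = G" using psd_sqrt[OF \<open>psd n G\<close>] by (auto simp: T_def)
  have T: "T \<in> carrier_mat n n" using psdT by (simp add: psd_def)
  obtain w t where wt: "eigensystem n n T w t" and t0: "\<And>k. k < n \<Longrightarrow> 0 \<le> t k"
    using psd_eigensystem[OF psdT] by blast
  have on: "(\<Sum>i<n. w k i * cnj (w m i)) = (if k = m then 1 else 0)" if "k < n" "m < n" for k m
    using wt that by (auto simp: eigensystem_def orthonormal_def)
  have Tw: "(\<Sum>j<n. T $$ (i, j) * w k j) = of_real (t k) * w k i" if "k < n" "i < n" for k i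
    using wt that by (auto simp: eigensystem_def)
  have "mat_trace T = (\<Sum>i<n. \<Sum>k<n. of_real (t k) * w k i * cnj (w k i))"
    using T unfolding mat_trace_def by (auto intro!: sum.cong simp: eigensystem_expand[OF T wt])
  also have "\<dots> = (\<Sum>k<n. of_real (t k) * (\<Sum>i<n. w k i * cnj (w k i)))"
    by (subst sum.swap) (simp add: sum_distrib_left mult_ac)
  also have "\<dots> = of_real (\<Sum>k<n. t k)" by (simp add: on)
  finally have tn: "trace_norm A = (\<Sum>k<n. t k)"
    using A by (simp add: trace_norm_def G_def[symmetric] T_def[symmetric])

  define Aw where "Aw k a = (\<Sum>j<n. A $$ (a, j) * w k j)" for k a
  have Gw: "(\<Sum>j<n. G $$ (i, j) * w k j) = of_real (t k * t k) * w k i" if "k < n" "i < n" for k i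
  proof -
    have "(\<Sum>j<n. G $$ (i, j) * w k j) = (\<Sum>j<n. \<Sum>b<n. T $$ (i, b) * (T $$ (b, j) * w k j))"
      unfolding TT[symmetric] using that
      by (intro sum.cong refl) (simp add: mult_mat_index[OF T T] sum_distrib_right mult.assoc del: index_mult_mat(1))
    also have "\<dots> = (\<Sum>b<n. T $$ (i, b) * (\<Sum>j<n. T $$ (b, j) * w k j))"
      by (subst sum.swap) (simp add: sum_distrib_left)
    also have "\<dots> = (\<Sum>b<n. of_real (t k) * (T $$ (i, b) * w k b))"
      using that by (intro sum.cong refl) (simp add: Tw)
    also have "\<dots> = of_real (t k * t k) * w k i"
      using that by (simp add: Tw sum_distrib_left[symmetric])
    finally show ?thesis .
  qed
  have AwAw: "(\<Sum>a<n. Aw k a * cnj (Aw m a)) = (if k = m then of_real (t k * t k) else 0)"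
    if "k < n" "m < n" for k m
  proof -
    have "(\<Sum>a<n. Aw k a * cnj (Aw m a))
        = (\<Sum>a<n. \<Sum>i<n. \<Sum>j<n. cnj (A $$ (a, i)) * A $$ (a, j) * w k j * cnj (w m i))"
      unfolding Aw_def by (intro sum.cong refl) (simp add: sum_product, subst sum.swap, simp add: mult_ac)
    also have "\<dots> = (\<Sum>i<n. \<Sum>a<n. \<Sum>j<n. cnj (A $$ (a, i)) * A $$ (a, j) * w k j * cnj (w m i))"
      by (rule sum.swap)
    also have "\<dots> = (\<Sum>i<n. \<Sum>j<n. \<Sum>a<n. cnj (A $$ (a, i)) * A $$ (a, j) * w k j * cnj (w m i))"
      by (intro sum.cong refl sum.swap)
    also have "\<dots> = (\<Sum>i<n. (\<Sum>j<n. G $$ (i, j) * w k j) * cnj (w m i))"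
      by (intro sum.cong refl) (simp add: G_ij sum_distrib_right)
    also have "\<dots> = (\<Sum>i<n. of_real (t k * t k) * (w k i * cnj (w m i)))"
      using that by (intro sum.cong refl) (simp add: Gw)
    also have "\<dots> = of_real (t k * t k) * (if k = m then 1 else 0)"
      using that by (simp add: on sum_distrib_left[symmetric])
    finally show ?thesis by simp
  qed
  text \<open>Division by zero makes \<open>u k\<close> vanish when \<open>t k = 0\<close>.\<close>
  define u where "u k a = Aw k a / of_real (t k)" for k a
  have uu: "(\<Sum>a<n. u k a * cnj (u m a)) = (if k = m \<and> t k \<noteq> 0 then 1 else 0)"
    if "k < n" "m < n" for k m
  proof -
    have "(\<Sum>a<n. u k a * cnj (u m a)) = (\<Sum>a<n. Aw k a * cnj (Aw m a)) / of_real (t k * t m)"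
      unfolding u_def sum_divide_distrib by simp
    then show ?thesis using AwAw[OF that] by auto
  qed
  have Awu: "(\<Sum>a<n. Aw k a * cnj (u k a)) = of_real (t k)" if "k < n" for k
  proof -
    have "(\<Sum>a<n. Aw k a * cnj (u k a)) = (\<Sum>a<n. Aw k a * cnj (Aw k a)) / of_real (t k)"
      unfolding u_def sum_divide_distrib by simp
    then show ?thesis using AwAw[OF that that] by simp
  qed
  \<comment> \<open>\<open>c k\<close> is the conjugate of the adjoint of \<open>K\<close> applied
    to \<open>u k\<close>, and \<open>Bw k\<close> is \<open>B\<close> applied to
    \<open>w k\<close>; \<open>t k\<close> is their product without conjugation.\<close>
  define c where "c k j = (\<Sum>a<n. K $$ (a, j) * cnj (u k a))" for k j
  define Bw where "Bw k j = (\<Sum>i<n. B $$ (j, i) * w k i)" for k j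
  \<comment> \<open>Where \<open>t k = 0\<close>, both \<open>u k\<close> and \<open>c k j\<close>
    vanish, so the Gram matrix of the \<open>u k\<close> still fixes the coefficients.\<close>
  have c_le: "(\<Sum>k<n. (cmod (c k j))\<^sup>2) \<le> (\<Sum>a<n. (cmod (K $$ (a, j)))\<^sup>2)" for j
  proof (rule bessel_gram)
    fix k assume k: "k \<in> {..<n}"
    have "(\<Sum>l<n. c l j * (\<Sum>a<n. u l a * cnj (u k a))) = (\<Sum>l<n. if l = k then c k j * (if t k = 0 then 0 else 1) else 0)"
      using k by (intro sum.cong refl) (auto simp: uu)
    also have "\<dots> = c k j * (if t k = 0 then 0 else 1)" using k by simp
    also have "\<dots> = c k j" by (auto simp: c_def u_def)
    finally show "(\<Sum>l<n. c l j * (\<Sum>a<n. u l a * cnj (u k a))) = c k j" .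
  qed (auto simp: c_def)
  have B_le: "(\<Sum>k<n. (cmod (Bw k j))\<^sup>2) \<le> (\<Sum>i<n. (cmod (B $$ (j, i)))\<^sup>2)" for j
  proof (rule bessel_gram)
    fix k assume k: "k \<in> {..<n}"
    have "(\<Sum>l<n. Bw l j * (\<Sum>i<n. cnj (w l i) * cnj (cnj (w k i)))) = (\<Sum>l<n. if l = k then Bw k j else 0)"
      using k by (intro sum.cong refl) (auto simp: on mult.commute[of "cnj _"])
    then show "(\<Sum>l<n. Bw l j * (\<Sum>i<n. cnj (w l i) * cnj (cnj (w k i)))) = Bw k j" using k by simp
  qed (auto simp: Bw_def)
  have tk: "of_real (t k) = (\<Sum>j<n. Bw k j * c k j)" if k: "k < n" for k
  proof -
    have Aw: "Aw k a = (\<Sum>j<n. K $$ (a, j) * Bw k j)" if a: "a < n" for a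
    proof -
      have "Aw k a = (\<Sum>i<n. \<Sum>j<n. K $$ (a, j) * (B $$ (j, i) * w k i))"
        unfolding Aw_def A_def using a
        by (intro sum.cong refl) (simp add: mult_mat_index[OF K B] sum_distrib_right mult.assoc del: index_mult_mat(1))
      also have "\<dots> = (\<Sum>j<n. K $$ (a, j) * Bw k j)"
        by (subst sum.swap) (simp add: Bw_def sum_distrib_left)
      finally show ?thesis .
    qed
    have "of_real (t k) = (\<Sum>a<n. (\<Sum>j<n. K $$ (a, j) * Bw k j) * cnj (u k a))"
      unfolding Awu[OF k, symmetric] by (intro sum.cong refl) (simp add: Aw)
    also have "\<dots> = (\<Sum>j<n. \<Sum>a<n. K $$ (a, j) * Bw k j * cnj (u k a))"
      unfolding sum_distrib_right by (rule sum.swap)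
    also have "\<dots> = (\<Sum>j<n. Bw k j * c k j)"
      by (simp add: c_def sum_distrib_left mult_ac)
    finally show ?thesis .
  qed
  have "0 \<le> (\<Sum>k<n. t k)" using t0 by (intro sum_nonneg) auto
  then have "trace_norm A = cmod (of_real (\<Sum>k<n. t k))"
    unfolding tn norm_of_real by simp
  also have "of_real (\<Sum>k<n. t k) = (\<Sum>(k, j)\<in>{..<n} \<times> {..<n}. Bw k j * c k j)"
    by (simp add: tk sum.cartesian_product)
  also have "cmod \<dots> \<le> sqrt (\<Sum>(k, j)\<in>{..<n} \<times> {..<n}. (cmod (Bw k j))\<^sup>2)
       * sqrt (\<Sum>(k, j)\<in>{..<n} \<times> {..<n}. (cmod (c k j))\<^sup>2)"
    using cauchy_schwarz_complex_sum[of "\<lambda>(k, j). Bw k j" "\<lambda>(k, j). c k j" "{..<n} \<times> {..<n}"]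
    by (simp add: case_prod_unfold)
  also have "(\<Sum>(k, j)\<in>{..<n} \<times> {..<n}. (cmod (Bw k j))\<^sup>2) = (\<Sum>j<n. \<Sum>k<n. (cmod (Bw k j))\<^sup>2)"
    by (subst sum.swap) (simp add: sum.cartesian_product)
  also have "(\<Sum>(k, j)\<in>{..<n} \<times> {..<n}. (cmod (c k j))\<^sup>2) = (\<Sum>j<n. \<Sum>k<n. (cmod (c k j))\<^sup>2)"
    by (subst sum.swap) (simp add: sum.cartesian_product)
  also have "sqrt (\<Sum>j<n. \<Sum>k<n. (cmod (Bw k j))\<^sup>2) * sqrt (\<Sum>j<n. \<Sum>k<n. (cmod (c k j))\<^sup>2)
     \<le> sqrt (\<Sum>j<n. \<Sum>i<n. (cmod (B $$ (j, i)))\<^sup>2) * sqrt (\<Sum>j<n. \<Sum>a<n. (cmod (K $$ (a, j)))\<^sup>2)"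
    by (intro mult_mono real_sqrt_le_mono sum_mono[OF c_le] sum_mono[OF B_le] real_sqrt_ge_zero sum_nonneg) auto
  also have "(\<Sum>j<n. \<Sum>a<n. (cmod (K $$ (a, j)))\<^sup>2) = frob_sq K"
    using K by (subst sum.swap) (simp add: frob_sq_def)
  also have "(\<Sum>j<n. \<Sum>i<n. (cmod (B $$ (j, i)))\<^sup>2) = frob_sq B"
    using B by (simp add: frob_sq_def)
  finally show ?thesis unfolding A_def by (simp add: mult.commute)
qed

text \<open>Resolves an estimate in which the quantity \<open>b\<close> to be bounded reappears
  under a root on the right.\<close>

lemma le_of_le_sqrt_mult_sqrt:
  fixes a b :: real
  assumes "0 \<le> a" "0 \<le> b" "b \<le> sqrt a * sqrt b"
  shows "b \<le> a"
proof (cases "b = 0")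
  case False
  then have "0 < sqrt b" "sqrt b * sqrt b \<le> sqrt a * sqrt b" using assms by auto
  then have "sqrt b \<le> sqrt a" by (rule mult_right_le_imp_le[rotated])
  then show ?thesis by simp
qed (use assms in simp)

text \<open>With \<open>Q = K K\<^sup>\<dagger>\<close>, this is the trace of \<open>P Q\<^sup>-\<^sup>1 P \<le> c P\<close>, a consequence of \<open>P \<le> c Q\<close>.\<close>

lemma frob_sq_inverse_mult_le:
  assumes P: "psd n P"
    and K: "K \<in> carrier_mat n n" and H: "H \<in> carrier_mat n n" "H * K = 1\<^sub>m n"
    and c: "0 \<le> c"
    and le: "\<And>x. Re (quad n P x) \<le> c * (\<Sum>j<n. (cmod (\<Sum>i<n. cnj (K $$ (i, j)) * x i))\<^sup>2)"
  shows "frob_sq (H * P) \<le> c * Re (mat_trace P)"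
proof -
  have Pc: "P \<in> carrier_mat n n" using P by (simp add: psd_def)
  obtain y where y: "\<And>i j. i < n \<Longrightarrow> j < n \<Longrightarrow> P $$ (i, j) = (\<Sum>k<n. y k i * cnj (y k j))"
    using psd_gramE[OF P] by blast
  define z where "z k i = (\<Sum>a<n. H $$ (i, a) * y k a)" for k i
  have HP: "(H * P) $$ (i, j) = (\<Sum>k<n. z k i * cnj (y k j))" if "i < n" "j < n" for i j
  proof -
    have "(H * P) $$ (i, j) = (\<Sum>a<n. \<Sum>k<n. H $$ (i, a) * (y k a * cnj (y k j)))"
      unfolding mult_mat_index[OF H(1) Pc that] using that
      by (intro sum.cong refl) (simp add: y sum_distrib_left)
    also have "\<dots> = (\<Sum>k<n. z k i * cnj (y k j))"
      by (subst sum.swap) (simp add: z_def sum_distrib_right sum_distrib_left mult_ac)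
    finally show ?thesis .
  qed
  have col: "(\<Sum>i<n. (cmod ((H * P) $$ (i, j)))\<^sup>2) \<le> c * (\<Sum>k<n. (cmod (y k j))\<^sup>2)" if j: "j < n" for j
  proof -
    \<comment> \<open>\<open>x\<close> is the adjoint of \<open>H\<close> applied to the column
      \<open>g\<close>, so the adjoint of \<open>K\<close> sends it back to \<open>g\<close>. Then
      \<open>le\<close> at \<open>x\<close> bounds the squared norm of \<open>\<gamma>\<close> by
      \<open>c * ?G\<close>, while Cauchy-Schwarz bounds \<open>?G\<close> by the norm of
      \<open>\<gamma>\<close> times \<open>sqrt ?b\<close>. Cancelling a root of \<open>?G\<close>
      leaves the column estimate.\<close>
    define g where "g i = (H * P) $$ (i, j)" for i
    define x where "x a = (\<Sum>i<n. cnj (H $$ (i, a)) * g i)" for a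
    define \<gamma> where "\<gamma> k = (\<Sum>i<n. cnj (z k i) * g i)" for k
    let ?G = "\<Sum>i<n. (cmod (g i))\<^sup>2" and ?b = "\<Sum>k<n. (cmod (y k j))\<^sup>2"
    have Kx: "(\<Sum>a<n. cnj (K $$ (a, l)) * x a) = g l" if l: "l < n" for l
    proof -
      have "(\<Sum>a<n. cnj (K $$ (a, l)) * x a) = (\<Sum>a<n. \<Sum>i<n. cnj (K $$ (a, l)) * (cnj (H $$ (i, a)) * g i))"
        by (simp add: x_def sum_distrib_left)
      also have "\<dots> = (\<Sum>i<n. cnj (\<Sum>a<n. H $$ (i, a) * K $$ (a, l)) * g i)"
        by (subst sum.swap) (simp add: sum_distrib_right sum_distrib_left mult_ac)
      also have "\<dots> = (\<Sum>i<n. cnj (1\<^sub>m n $$ (i, l)) * g i)"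
        using l by (intro sum.cong refl) (simp add: mult_mat_index[OF H(1) K, symmetric] H(2) del: index_mult_mat(1))
      also have "\<dots> = (\<Sum>i<n. if i = l then g l else 0)"
        using l by (intro sum.cong refl) auto
      finally show ?thesis using l by simp
    qed
    have yx: "(\<Sum>a<n. cnj (y k a) * x a) = \<gamma> k" for k
    proof -
      have "(\<Sum>a<n. cnj (y k a) * x a) = (\<Sum>a<n. \<Sum>i<n. cnj (y k a) * (cnj (H $$ (i, a)) * g i))"
        by (simp add: x_def sum_distrib_left)
      also have "\<dots> = \<gamma> k"
        by (subst sum.swap) (simp add: \<gamma>_def z_def sum_distrib_right sum_distrib_left mult_ac)
      finally show ?thesis .
    qed
    have "(\<Sum>k<n. (cmod (\<gamma> k))\<^sup>2) = Re (quad n P x)"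
      by (subst quad_gram[where y = y and I = "{..<n}"]) (simp_all add: y yx)
    also have "\<dots> \<le> c * ?G"
      by (rule order_trans[OF le]) (simp add: Kx)
    finally have \<gamma>: "(\<Sum>k<n. (cmod (\<gamma> k))\<^sup>2) \<le> c * ?G" .
    have "complex_of_real ?G = (\<Sum>i<n. g i * cnj (g i))" by (simp only: sum_mult_cnj)
    also have "\<dots> = (\<Sum>i<n. \<Sum>k<n. z k i * cnj (y k j) * cnj (g i))"
      by (intro sum.cong refl) (simp add: g_def HP j sum_distrib_right)
    also have "\<dots> = (\<Sum>k<n. cnj (y k j) * cnj (\<gamma> k))"
      by (subst sum.swap) (simp add: \<gamma>_def sum_distrib_left mult_ac)
    finally have "cmod (of_real ?G) = cmod (\<Sum>k<n. cnj (y k j) * cnj (\<gamma> k))"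
      by (rule arg_cong)
    then have "?G = cmod (\<Sum>k<n. cnj (y k j) * cnj (\<gamma> k))"
      unfolding norm_of_real by (simp add: sum_nonneg)
    also have "\<dots> \<le> sqrt ?b * sqrt (\<Sum>k<n. (cmod (\<gamma> k))\<^sup>2)"
      using cauchy_schwarz_complex_sum[of "\<lambda>k. cnj (y k j)" "\<lambda>k. cnj (\<gamma> k)" "{..<n}"] by simp
    also have "\<dots> \<le> sqrt ?b * sqrt (c * ?G)"
      using \<gamma> by (intro mult_left_mono) (auto intro!: sum_nonneg)
    finally have "?G \<le> sqrt (?b * c) * sqrt ?G" by (simp add: real_sqrt_mult mult_ac)
    moreover have G0: "0 \<le> ?G" and b0: "0 \<le> ?b" by (auto intro!: sum_nonneg)
    ultimately have "?G \<le> ?b * c"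
      using c by (metis le_of_le_sqrt_mult_sqrt mult_nonneg_nonneg)
    then have "?G \<le> c * ?b" by (simp add: mult.commute)
    then show ?thesis by (simp add: g_def)
  qed
  have "frob_sq (H * P) = (\<Sum>j<n. \<Sum>i<n. (cmod ((H * P) $$ (i, j)))\<^sup>2)"
    using H Pc by (subst sum.swap) (simp add: frob_sq_def)
  also have "\<dots> \<le> (\<Sum>j<n. c * (\<Sum>k<n. (cmod (y k j))\<^sup>2))"
    using col by (intro sum_mono) auto
  also have "\<dots> = c * Re (\<Sum>j<n. \<Sum>k<n. y k j * cnj (y k j))"
    by (simp add: sum_mult_cnj sum_distrib_left del: of_real_sum)
  also have "(\<Sum>j<n. \<Sum>k<n. y k j * cnj (y k j)) = mat_trace P"
    using Pc by (simp add: mat_trace_def y)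
  finally show ?thesis .
qed

section \<open>Mutually unbiased bases and pairwise independent permutations\<close>

text \<open>The traceless parts of the projections of one basis have Gram matrix identity minus
  \<open>1/N\<close>, and those of different bases are orthogonal. They are linearly dependent,
  since they sum to zero in each basis; but the coefficients \<open>p \<theta> n - t\<close> also
  sum to zero in each basis, so the Gram matrix fixes them and \<open>bessel_gram\<close>
  applies.\<close>

lemma unbiased_bessel:
  fixes u :: "'t \<Rightarrow> nat \<Rightarrow> nat \<Rightarrow> complex" and X :: "nat \<Rightarrow> nat \<Rightarrow> complex"
  assumes N: "0 < N" and fin: "finite \<Theta>"
    and row: "\<And>\<theta> n m. \<theta> \<in> \<Theta> \<Longrightarrow> n < N \<Longrightarrow> m < N \<Longrightarrow>
      (\<Sum>x<N. u \<theta> n x * cnj (u \<theta> m x)) = (if n = m then 1 else 0)"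
    and col: "\<And>\<theta> x y. \<theta> \<in> \<Theta> \<Longrightarrow> x < N \<Longrightarrow> y < N \<Longrightarrow>
      (\<Sum>n<N. u \<theta> n x * cnj (u \<theta> n y)) = (if x = y then 1 else 0)"
    and unb: "\<And>\<theta> \<eta> n m. \<theta> \<in> \<Theta> \<Longrightarrow> \<eta> \<in> \<Theta> \<Longrightarrow> \<theta> \<noteq> \<eta> \<Longrightarrow> n < N \<Longrightarrow> m < N \<Longrightarrow>
      (cmod (\<Sum>x<N. u \<theta> n x * cnj (u \<eta> m x)))\<^sup>2 = 1 / real N"
  defines "p \<equiv> \<lambda>\<theta> n. \<Sum>x<N. \<Sum>y<N. u \<theta> n x * X x y * cnj (u \<theta> n y)"
  shows "\<And>\<theta>. \<theta> \<in> \<Theta> \<Longrightarrow> (\<Sum>n<N. p \<theta> n - (\<Sum>x<N. X x x) / of_nat N) = 0"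
    and "(\<Sum>\<theta>\<in>\<Theta>. \<Sum>n<N. (cmod (p \<theta> n - (\<Sum>x<N. X x x) / of_nat N))\<^sup>2)
      \<le> (\<Sum>x<N. \<Sum>y<N. (cmod (X x y))\<^sup>2)"
proof -
  define t where "t = (\<Sum>x<N. X x x) / of_nat N"
  show sum0: "(\<Sum>n<N. p \<theta> n - (\<Sum>x<N. X x x) / of_nat N) = 0" if "\<theta> \<in> \<Theta>" for \<theta>
  proof -
    have "(\<Sum>n<N. p \<theta> n) = (\<Sum>x<N. \<Sum>n<N. \<Sum>y<N. u \<theta> n x * X x y * cnj (u \<theta> n y))"
      unfolding p_def by (rule sum.swap)
    also have "\<dots> = (\<Sum>x<N. \<Sum>y<N. \<Sum>n<N. u \<theta> n x * X x y * cnj (u \<theta> n y))"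
      by (intro sum.cong refl sum.swap)
    also have "\<dots> = (\<Sum>x<N. \<Sum>y<N. X x y * (\<Sum>n<N. u \<theta> n x * cnj (u \<theta> n y)))"
      by (simp add: sum_distrib_left mult_ac)
    also have "\<dots> = (\<Sum>x<N. \<Sum>y<N. if y = x then X x x else 0)"
      by (intro sum.cong refl) (auto simp: col[OF that])
    also have "\<dots> = (\<Sum>x<N. X x x)" by simp
    finally show ?thesis using N by (simp add: sum_subtractf)
  qed
  text \<open>The vectors are the basis projections minus their common part \<open>1/N\<close>.\<close>
  define e where "e = (\<lambda>(\<theta>, n) (x, y). cnj (u \<theta> n x) * u \<theta> n y - (if x = y then 1 / of_nat N else 0))"
  define c where "c = (\<lambda>(\<theta>, n). p \<theta> n - t)"
  have inner: "(\<Sum>j\<in>{..<N} \<times> {..<N}. e (\<eta>, m) j * cnj (e (\<theta>, n) j))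
      = of_real ((cmod (\<Sum>x<N. u \<theta> n x * cnj (u \<eta> m x)))\<^sup>2) - 1 / of_nat N"
    if "\<theta> \<in> \<Theta>" "\<eta> \<in> \<Theta>" "n < N" "m < N" for \<theta> \<eta> n m
  proof -
    let ?i = "1 / complex_of_nat N"
    let ?o = "\<Sum>x<N. u \<theta> n x * cnj (u \<eta> m x)"
    have "(\<Sum>j\<in>{..<N} \<times> {..<N}. e (\<eta>, m) j * cnj (e (\<theta>, n) j))
       = (\<Sum>x<N. \<Sum>y<N. (u \<theta> n x * cnj (u \<eta> m x)) * (cnj (u \<theta> n y) * u \<eta> m y)
            - (if y = x then u \<eta> m x * cnj (u \<eta> m x) * ?i else 0)
            - (if y = x then u \<theta> n x * cnj (u \<theta> n x) * ?i else 0) + (if y = x then ?i * ?i else 0))"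
      unfolding sum.cartesian_product by (intro sum.cong refl) (auto simp: e_def algebra_simps)
    also have "\<dots> = ?o * cnj ?o - (\<Sum>x<N. u \<eta> m x * cnj (u \<eta> m x)) * ?i
        - (\<Sum>x<N. u \<theta> n x * cnj (u \<theta> n x)) * ?i + of_nat N * (?i * ?i)"
      by (simp add: sum.distrib sum_subtractf sum_product sum_divide_distrib)
    also have "\<dots> = ?o * cnj ?o - ?i" using N that by (simp add: row)
    finally show ?thesis by (simp only: complex_norm_square)
  qed
  have "(\<Sum>k\<in>\<Theta> \<times> {..<N}. (cmod (c k))\<^sup>2) \<le> (\<Sum>j\<in>{..<N} \<times> {..<N}. (cmod ((\<lambda>(x, y). X x y) j))\<^sup>2)"
  proof (rule bessel_gram)
    fix k assume k: "k \<in> \<Theta> \<times> {..<N}"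
    then obtain \<theta> n where kd: "k = (\<theta>, n)" "\<theta> \<in> \<Theta>" "n < N" by auto
    have "(\<Sum>j\<in>{..<N} \<times> {..<N}. (\<lambda>(x, y). X x y) j * cnj (e k j))
       = (\<Sum>x<N. \<Sum>y<N. u \<theta> n x * X x y * cnj (u \<theta> n y) - (if y = x then X x x / of_nat N else 0))"
      unfolding sum.cartesian_product kd by (intro sum.cong refl) (auto simp: e_def algebra_simps)
    then show "c k = (\<Sum>j\<in>{..<N} \<times> {..<N}. (\<lambda>(x, y). X x y) j * cnj (e k j))"
      by (simp add: c_def kd p_def t_def sum_subtractf sum_divide_distrib)
    have "(\<Sum>l\<in>\<Theta> \<times> {..<N}. c l * (\<Sum>j\<in>{..<N} \<times> {..<N}. e l j * cnj (e k j)))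
       = (\<Sum>\<eta>\<in>\<Theta>. \<Sum>m<N. (p \<eta> m - t) *
           (of_real ((cmod (\<Sum>x<N. u \<theta> n x * cnj (u \<eta> m x)))\<^sup>2) - 1 / of_nat N))"
      unfolding sum.cartesian_product using kd
      by (intro sum.cong refl) (auto simp: c_def inner)
    \<comment> \<open>In another basis every Gram entry vanishes by unbiasedness; in the same basis
      the contribution of \<open>-1/N\<close> vanishes by \<open>sum0\<close>.\<close>
    also have "\<dots> = (\<Sum>\<eta>\<in>\<Theta>. if \<eta> = \<theta> then p \<theta> n - t else 0)"
    proof (intro sum.cong refl)
      fix \<eta> assume \<eta>: "\<eta> \<in> \<Theta>"
      show "(\<Sum>m<N. (p \<eta> m - t) *
           (of_real ((cmod (\<Sum>x<N. u \<theta> n x * cnj (u \<eta> m x)))\<^sup>2) - 1 / of_nat N))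
           = (if \<eta> = \<theta> then p \<theta> n - t else 0)"
      proof (cases "\<eta> = \<theta>")
        case True
        have "(\<Sum>m<N. (p \<theta> m - t) *
           (of_real ((cmod (\<Sum>x<N. u \<theta> n x * cnj (u \<theta> m x)))\<^sup>2) - 1 / of_nat N))
           = (\<Sum>m<N. (if m = n then p \<theta> n - t else 0) - (p \<theta> m - t) * (1 / of_nat N))"
          using kd by (intro sum.cong refl) (auto simp: row right_diff_distrib)
        also have "\<dots> = (\<Sum>m<N. if m = n then p \<theta> n - t else 0) - (\<Sum>m<N. p \<theta> m - t) * (1 / of_nat N)"
          by (subst sum_subtractf) (simp only: sum_distrib_right)
        also have "\<dots> = p \<theta> n - t" using kd sum0[OF kd(2)] by (simp add: t_def)
        finally show ?thesis using True by simp
      next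
        case False
        then show ?thesis using \<eta> kd by (simp add: unb)
      qed
    qed
    also have "\<dots> = c k" using kd fin by (simp add: c_def)
    finally show "(\<Sum>l\<in>\<Theta> \<times> {..<N}. c l * (\<Sum>j\<in>{..<N} \<times> {..<N}. e l j * cnj (e k j))) = c k" .
  qed (use fin in auto)
  then show "(\<Sum>\<theta>\<in>\<Theta>. \<Sum>n<N. (cmod (p \<theta> n - (\<Sum>x<N. X x x) / of_nat N))\<^sup>2)
      \<le> (\<Sum>x<N. \<Sum>y<N. (cmod (X x y))\<^sup>2)"
    unfolding sum.cartesian_product c_def t_def by (simp add: case_prod_unfold)
qed

section \<open>Unbiased bases as rows of unitaries\<close>

lemma unitary_mat_row:
  assumes "unitary_mat N U" "i < N" "j < N"
  shows "(\<Sum>x<N. U $$ (i, x) * cnj (U $$ (j, x))) = (if i = j then 1 else 0)"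
proof -
  have U: "U \<in> carrier_mat N N" "U * mat_adjoint U = 1\<^sub>m N" using assms by (auto simp: unitary_mat_def)
  have "(\<Sum>x<N. U $$ (i, x) * cnj (U $$ (j, x))) = (U * mat_adjoint U) $$ (i, j)"
    unfolding mult_mat_index[OF U(1) mat_adjoint_carrier[OF U(1)] assms(2,3)]
    using U(1) assms(3) by (intro sum.cong refl) (simp add: mat_adjoint_index)
  then show ?thesis using U assms by simp
qed

lemma unitary_mat_col:
  assumes "unitary_mat N U" "i < N" "j < N"
  shows "(\<Sum>x<N. U $$ (x, i) * cnj (U $$ (x, j))) = (if i = j then 1 else 0)"
proof -
  have U: "U \<in> carrier_mat N N" "mat_adjoint U * U = 1\<^sub>m N" using assms by (auto simp: unitary_mat_def)
  have "(\<Sum>x<N. U $$ (x, i) * cnj (U $$ (x, j))) = (mat_adjoint U * U) $$ (j, i)"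
    unfolding mult_mat_index[OF mat_adjoint_carrier[OF U(1)] U(1) assms(3,2)]
    using U(1) assms(3) by (intro sum.cong refl) (simp add: mat_adjoint_index)
  then show ?thesis using U assms by auto
qed

text \<open>The adjoint undoes \<open>U\<close>, so the vector sent to the \<open>k\<close>-th basis
  vector is column \<open>k\<close> of the adjoint. Through this, overlaps of basis vectors become
  overlaps of rows.\<close>

lemma unitary_mat_unit_vec:
  assumes U: "unitary_mat N U" and v: "v \<in> carrier_vec N" "U *\<^sub>v v = unit_vec N k"
    and k: "k < N" "x < N"
  shows "v $ x = cnj (U $$ (k, x))"
proof -
  have U': "U \<in> carrier_mat N N" "mat_adjoint U * U = 1\<^sub>m N" using U by (auto simp: unitary_mat_def)
  have a: "mat_adjoint U \<in> carrier_mat N N" using U' mat_adjoint_carrier by blast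
  have "v = mat_adjoint U *\<^sub>v unit_vec N k"
    unfolding v(2)[symmetric] using U' a v(1) by (simp flip: assoc_mult_mat_vec)
  then have "v $ x = (\<Sum>j<N. mat_adjoint U $$ (x, j) * unit_vec N k $ j)"
    using mult_mat_vec_index[OF a unit_vec_carrier k(2)] by simp
  also have "\<dots> = (\<Sum>j<N. if j = k then cnj (U $$ (k, x)) else 0)"
    using U' k by (intro sum.cong refl) (auto simp: mat_adjoint_index)
  finally show ?thesis using k by simp
qed

lemma full_mub_overlap:
  assumes mub: "full_mub N B U" and "\<theta> < N + 1" "\<eta> < N + 1" "\<theta> \<noteq> \<eta>" and nm: "n < N" "m < N"
  shows "(cmod (\<Sum>x<N. U \<theta> $$ (n, x) * cnj (U \<eta> $$ (m, x))))\<^sup>2 = 1 / real N"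
proof -
  have B: "B \<theta> n \<in> carrier_vec N" "B \<eta> m \<in> carrier_vec N"
    using assms unfolding full_mub_def onb_def by auto
  have Bx: "B \<theta> n $ x = cnj (U \<theta> $$ (n, x))" "B \<eta> m $ x = cnj (U \<eta> $$ (m, x))" if "x < N" for x
    using assms B that unfolding full_mub_def by (auto intro!: unitary_mat_unit_vec)
  have "B \<theta> n \<bullet>c B \<eta> m = cnj (\<Sum>x<N. U \<theta> $$ (n, x) * cnj (U \<eta> $$ (m, x)))"
    unfolding cscalar_prod_index[OF B] by (simp add: Bx)
  then have "cmod (\<Sum>x<N. U \<theta> $$ (n, x) * cnj (U \<eta> $$ (m, x))) = cmod (B \<theta> n \<bullet>c B \<eta> m)" by (simp only: complex_mod_cnj)
  also have "\<dots> = 1 / sqrt (real N)"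
    using assms unfolding full_mub_def mutually_unbiased_def by blast
  finally show ?thesis by (simp add: power_divide)
qed

section \<open>Pairwise independent permutations and affine maps\<close>

lemma pairwise_independent_sum:
  fixes F :: "'a \<Rightarrow> 'a \<Rightarrow> complex"
  assumes X: "finite X" and P: "pairwise_independent X PP" and l: "l1 \<in> X" "l2 \<in> X" "l1 \<noteq> l2"
  shows "(\<Sum>\<pi>\<in>PP. F (inv_into UNIV \<pi> l1) (inv_into UNIV \<pi> l2)) =
    of_real (card PP / (card X * (real (card X) - 1))) * (\<Sum>x1\<in>X. \<Sum>x2\<in>X - {x1}. F x1 x2)"
proof -
  have fin: "finite PP" and perm: "\<And>\<pi>. \<pi> \<in> PP \<Longrightarrow> \<pi> permutes X" and ne: "PP \<noteq> {}"
    using P by (auto simp: pairwise_independent_def)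
  \<comment> \<open>Each ordered pair of distinct points is the pair of preimages of
    \<open>l1, l2\<close> for equally many permutations.\<close>
  have cnt: "real (card {\<pi> \<in> PP. \<pi> x1 = l1 \<and> \<pi> x2 = l2}) = card PP / (card X * (real (card X) - 1))"
    if "x1 \<in> X" "x2 \<in> X" "x1 \<noteq> x2" for x1 x2
  proof -
    have "real (card {\<pi> \<in> PP. \<pi> x1 = l1 \<and> \<pi> x2 = l2}) / real (card PP)
          = 1 / (real (card X) * (real (card X) - 1))"
      using P that l unfolding pairwise_independent_def by blast
    then show ?thesis using fin ne by (simp add: field_simps)
  qed
  \<comment> \<open>The value at the preimages becomes a sum over all pairs with an indicator, so
    that the sum over permutations can be moved inside and turned into a count.\<close>
  have "F (inv_into UNIV \<pi> l1) (inv_into UNIV \<pi> l2) = (\<Sum>x1\<in>X. \<Sum>x2\<in>X - {x1}. if \<pi> x1 = l1 \<and> \<pi> x2 = l2 then F x1 x2 else 0)"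
    if \<pi>: "\<pi> \<in> PP" for \<pi>
  proof -
    note p = perm[OF \<pi>]
    have eq: "\<pi> x = l \<longleftrightarrow> x = inv_into UNIV \<pi> l" for x l using p by (metis permutes_inverses)
    have "(\<Sum>x1\<in>X. \<Sum>x2\<in>X - {x1}. if \<pi> x1 = l1 \<and> \<pi> x2 = l2 then F x1 x2 else 0)
      = (\<Sum>x1\<in>X. if x1 = inv_into UNIV \<pi> l1 then (\<Sum>x2\<in>X - {x1}. if x2 = inv_into UNIV \<pi> l2 then F x1 x2 else 0) else 0)"
      by (intro sum.cong refl) (auto simp: eq intro!: sum.cong)
    also have "\<dots> = (\<Sum>x2\<in>X - {inv_into UNIV \<pi> l1}. if x2 = inv_into UNIV \<pi> l2 then F (inv_into UNIV \<pi> l1) x2 else 0)"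
      using X l permutes_in_image[OF permutes_inv[OF p]] by simp
    also have "\<dots> = F (inv_into UNIV \<pi> l1) (inv_into UNIV \<pi> l2)"
      using X l permutes_in_image[OF permutes_inv[OF p]] permutes_inj[OF permutes_inv[OF p]]
      by (auto dest: injD)
    finally show ?thesis by simp
  qed
  then have "(\<Sum>\<pi>\<in>PP. F (inv_into UNIV \<pi> l1) (inv_into UNIV \<pi> l2))
    = (\<Sum>\<pi>\<in>PP. \<Sum>x1\<in>X. \<Sum>x2\<in>X - {x1}. if \<pi> x1 = l1 \<and> \<pi> x2 = l2 then F x1 x2 else 0)"
    by (intro sum.cong refl) auto
  also have "\<dots> = (\<Sum>x1\<in>X. \<Sum>\<pi>\<in>PP. \<Sum>x2\<in>X - {x1}. if \<pi> x1 = l1 \<and> \<pi> x2 = l2 then F x1 x2 else 0)"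
    by (rule sum.swap)
  also have "\<dots> = (\<Sum>x1\<in>X. \<Sum>x2\<in>X - {x1}. \<Sum>\<pi>\<in>PP. if \<pi> x1 = l1 \<and> \<pi> x2 = l2 then F x1 x2 else 0)"
    by (intro sum.cong refl sum.swap)
  also have "\<dots> = (\<Sum>x1\<in>X. \<Sum>x2\<in>X - {x1}. of_real (real (card {\<pi> \<in> PP. \<pi> x1 = l1 \<and> \<pi> x2 = l2})) * F x1 x2)"
    using fin by (intro sum.cong refl) (simp flip: sum.inter_filter)
  also have "\<dots> = (\<Sum>x1\<in>X. \<Sum>x2\<in>X - {x1}. of_real (card PP / (card X * (real (card X) - 1))) * F x1 x2)"
    by (intro sum.cong refl) (subst cnt, auto)
  finally show ?thesis by (simp only: sum_distrib_left)
qed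

lemma pairwise_independent_second_moment:
  fixes q :: "'a \<Rightarrow> complex"
  assumes X: "finite X" and P: "pairwise_independent X PP"
    and lab: "bij_betw (\<lambda>(m, m'). lab m m') (I \<times> J) X" and IJ: "finite I" "finite J"
    and q0: "(\<Sum>x\<in>X. q x) = 0"
  shows "(\<Sum>\<pi>\<in>PP. \<Sum>m\<in>I. (cmod (\<Sum>m'\<in>J. q (inv_into UNIV \<pi> (lab m m'))))\<^sup>2)
     \<le> real (card PP) * (\<Sum>x\<in>X. (cmod (q x))\<^sup>2)"
proof -
  let ?Q = "\<Sum>x\<in>X. (cmod (q x))\<^sup>2"
  \<comment> \<open>\<open>-\<kappa>\<close> is the sum over the permutations of the product at two
    distinct preimages, see \<open>E\<close>.\<close>
  define \<kappa> where "\<kappa> = real (card PP) / (card X * (real (card X) - 1)) * ?Q"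
  have labX: "lab m m' \<in> X" if "m \<in> I" "m' \<in> J" for m m'
    using lab that by (auto simp: bij_betw_def)
  have labi: "lab m m' \<noteq> lab m m''" if "m \<in> I" "m' \<in> J" "m'' \<in> J" "m' \<noteq> m''" for m m' m''
    using lab that by (auto simp: bij_betw_def inj_on_def)
  \<comment> \<open>For empty \<open>X\<close> the real factor \<open>card X - 1\<close> is
    negative, hence the case distinction. For a single point the denominator is zero, so the
    quotient is zero by convention.\<close>
  have \<kappa>: "0 \<le> \<kappa>"
  proof (cases "card X = 0")
    case False
    then have "1 \<le> real (card X)" by simp
    then show ?thesis unfolding \<kappa>_def by (intro mult_nonneg_nonneg divide_nonneg_nonneg sum_nonneg) auto
  qed (simp add: \<kappa>_def)
  have off: "(\<Sum>x1\<in>X. \<Sum>x2\<in>X - {x1}. q x1 * cnj (q x2)) = - of_real ?Q"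
  proof -
    have "(\<Sum>x2\<in>X - {x1}. cnj (q x2)) = - cnj (q x1)" if "x1 \<in> X" for x1
      using sum.remove[OF X that, of "\<lambda>x. cnj (q x)"] arg_cong[OF q0, of cnj]
      by (simp add: eq_neg_iff_add_eq_0 add.commute)
    then have "(\<Sum>x1\<in>X. \<Sum>x2\<in>X - {x1}. q x1 * cnj (q x2)) = (\<Sum>x1\<in>X. - (q x1 * cnj (q x1)))"
      by (intro sum.cong refl) (simp flip: sum_distrib_left)
    then show ?thesis by (simp only: sum_negf sum_mult_cnj)
  qed
  have E: "(\<Sum>\<pi>\<in>PP. q (inv_into UNIV \<pi> l1) * cnj (q (inv_into UNIV \<pi> l2))) = - of_real \<kappa>"
    if "l1 \<in> X" "l2 \<in> X" "l1 \<noteq> l2" for l1 l2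
    using pairwise_independent_sum[OF X P that, of "\<lambda>x y. q x * cnj (q y)"] by (simp add: off \<kappa>_def)
  have diag: "(\<Sum>m\<in>I. \<Sum>m'\<in>J. (cmod (q (inv_into UNIV \<pi> (lab m m'))))\<^sup>2) = ?Q" if "\<pi> \<in> PP" for \<pi>
  proof -
    have p: "inv_into UNIV \<pi> permutes X" using P that by (auto simp: pairwise_independent_def permutes_inv)
    have "(\<Sum>m\<in>I. \<Sum>m'\<in>J. (cmod (q (inv_into UNIV \<pi> (lab m m'))))\<^sup>2)
        = (\<Sum>x\<in>I \<times> J. (cmod (q (inv_into UNIV \<pi> ((\<lambda>(m, m'). lab m m') x))))\<^sup>2)"
      by (simp add: sum.cartesian_product case_prod_unfold)
    also have "\<dots> = (\<Sum>x\<in>X. (cmod (q (inv_into UNIV \<pi> x)))\<^sup>2)"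
      by (rule sum.reindex_bij_betw[OF lab])
    also have "\<dots> = ?Q"
      by (rule sum.reindex_bij_betw[OF permutes_imp_bij[OF p]])
    finally show ?thesis .
  qed
  have "complex_of_real (\<Sum>\<pi>\<in>PP. \<Sum>m\<in>I. (cmod (\<Sum>m'\<in>J. q (inv_into UNIV \<pi> (lab m m'))))\<^sup>2)
     = (\<Sum>\<pi>\<in>PP. \<Sum>m\<in>I. \<Sum>m'\<in>J. \<Sum>m''\<in>J. q (inv_into UNIV \<pi> (lab m m')) * cnj (q (inv_into UNIV \<pi> (lab m m''))))"
    unfolding of_real_sum complex_norm_square by (simp add: sum_product)
  also have "\<dots> = (\<Sum>m\<in>I. \<Sum>\<pi>\<in>PP. \<Sum>m'\<in>J. \<Sum>m''\<in>J. q (inv_into UNIV \<pi> (lab m m')) * cnj (q (inv_into UNIV \<pi> (lab m m''))))"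
    by (rule sum.swap)
  also have "\<dots> = (\<Sum>m\<in>I. \<Sum>m'\<in>J. \<Sum>\<pi>\<in>PP. \<Sum>m''\<in>J. q (inv_into UNIV \<pi> (lab m m')) * cnj (q (inv_into UNIV \<pi> (lab m m''))))"
    by (intro sum.cong refl sum.swap)
  also have "\<dots> = (\<Sum>m\<in>I. \<Sum>m'\<in>J. \<Sum>m''\<in>J. \<Sum>\<pi>\<in>PP. q (inv_into UNIV \<pi> (lab m m')) * cnj (q (inv_into UNIV \<pi> (lab m m''))))"
    by (intro sum.cong refl sum.swap)
  also have "\<dots> = (\<Sum>m\<in>I. \<Sum>m'\<in>J. (\<Sum>\<pi>\<in>PP. q (inv_into UNIV \<pi> (lab m m')) * cnj (q (inv_into UNIV \<pi> (lab m m'))))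
      + (\<Sum>m''\<in>J - {m'}. \<Sum>\<pi>\<in>PP. q (inv_into UNIV \<pi> (lab m m')) * cnj (q (inv_into UNIV \<pi> (lab m m'')))))"
    using IJ by (intro sum.cong refl sum.remove) auto
  also have "\<dots> = (\<Sum>m\<in>I. \<Sum>m'\<in>J. (\<Sum>\<pi>\<in>PP. of_real ((cmod (q (inv_into UNIV \<pi> (lab m m'))))\<^sup>2))
      + (\<Sum>m''\<in>J - {m'}. - of_real \<kappa>))"
    by (intro sum.cong refl arg_cong2[of _ _ _ _ "(+)"] E labX labi) (auto simp only: complex_norm_square)
  also have "\<dots> = of_real ((\<Sum>m\<in>I. \<Sum>m'\<in>J. \<Sum>\<pi>\<in>PP. (cmod (q (inv_into UNIV \<pi> (lab m m'))))\<^sup>2)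
      - (\<Sum>m\<in>I. \<Sum>m'\<in>J. card (J - {m'}) * \<kappa>))"
    by (simp add: sum.distrib sum_subtractf)
  finally have "(\<Sum>\<pi>\<in>PP. \<Sum>m\<in>I. (cmod (\<Sum>m'\<in>J. q (inv_into UNIV \<pi> (lab m m'))))\<^sup>2)
     = (\<Sum>m\<in>I. \<Sum>m'\<in>J. \<Sum>\<pi>\<in>PP. (cmod (q (inv_into UNIV \<pi> (lab m m'))))\<^sup>2)
      - (\<Sum>m\<in>I. \<Sum>m'\<in>J. card (J - {m'}) * \<kappa>)"
    unfolding of_real_eq_iff .
  also have "\<dots> \<le> (\<Sum>m\<in>I. \<Sum>m'\<in>J. \<Sum>\<pi>\<in>PP. (cmod (q (inv_into UNIV \<pi> (lab m m'))))\<^sup>2)"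
    using \<kappa> by (simp add: sum_nonneg)
  also have "\<dots> = (\<Sum>m\<in>I. \<Sum>\<pi>\<in>PP. \<Sum>m'\<in>J. (cmod (q (inv_into UNIV \<pi> (lab m m'))))\<^sup>2)"
    by (intro sum.cong refl sum.swap)
  also have "\<dots> = (\<Sum>\<pi>\<in>PP. \<Sum>m\<in>I. \<Sum>m'\<in>J. (cmod (q (inv_into UNIV \<pi> (lab m m'))))\<^sup>2)"
    by (rule sum.swap)
  also have "\<dots> = real (card PP) * ?Q" by (simp add: diag)
  finally show ?thesis .
qed

text \<open>Exactly one line passes through two points with distinct abscissae, and its slope is
  nonzero because the ordinates differ. Thus each event contains one of the
  \<open>N * (N - 1)\<close> maps.\<close>

lemma affine_perms_pairwise_independent:
  fixes enc :: "nat \<Rightarrow> 'x::{field,finite}"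
  assumes enc: "bij_betw enc {..<N} (UNIV :: 'x set)"
  shows "pairwise_independent {..<N} (affine_perms N enc)"
    and "card (affine_perms N enc) = N * (N - 1)"
proof -
  define dec where "dec = inv_into {..<N} enc"
  define f where "f a b = (\<lambda>x. if x < N then dec (a * enc x + b) else x)" for a b
  have aff: "affine_perms N enc = (\<lambda>(a, b). f a b) ` ((- {0}) \<times> UNIV)"
    unfolding affine_perms_def f_def dec_def by (auto simp: image_iff)
  have ed: "enc (dec y) = y" for y
    unfolding dec_def using enc by (simp add: bij_betw_inv_into_right)
  have dec_lt: "dec y < N" for y
    unfolding dec_def using bij_betw_inv_into[OF enc] by (auto simp: bij_betw_def)
  have de: "dec (enc x) = x" if "x < N" for x
    unfolding dec_def using enc that by (simp add: bij_betw_inv_into_left)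
  have f_eq: "f a b x = y \<longleftrightarrow> a * enc x + b = enc y" if "x < N" "y < N" for a b x y
    using that by (simp add: f_def) (metis ed de)
  \<comment> \<open>The values at \<open>0\<close> and \<open>1\<close> recover intercept and slope,
    so counting maps is counting pairs.\<close>
  have inj: "inj_on (\<lambda>(a, b). f a b) ((- {0}) \<times> UNIV)"
  proof (rule inj_onI)
    fix p p' assume eq: "(\<lambda>(a, b). f a b) p = (\<lambda>(a, b). f a b) p'"
    have "fst p * z + snd p = fst p' * z + snd p'" for z
      using fun_cong[OF eq, of "dec z"] by (simp add: f_def dec_lt ed case_prod_unfold) (metis ed)
    from this[of 0] this[of 1] show "p = p'" by (simp add: prod_eq_iff)
  qed
  have cardU: "card (UNIV :: 'x set) = N" using bij_betw_same_card[OF enc] by simp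
  show card: "card (affine_perms N enc) = N * (N - 1)"
    unfolding aff card_image[OF inj] using cardU
    by (simp add: card_cartesian_product Compl_eq_Diff_UNIV card_Diff_subset)
  have "N > 0" using cardU by (metis finite_UNIV_card_ge_0 finite)
  show "pairwise_independent {..<N} (affine_perms N enc)"
    unfolding pairwise_independent_def
  proof (intro conjI ballI impI)
    show "finite (affine_perms N enc)" unfolding aff by simp
    have "(\<lambda>(a, b). f a b) (1, 0) \<in> affine_perms N enc" unfolding aff by (rule imageI) simp
    then show "affine_perms N enc \<noteq> {}" by blast
    fix \<pi> assume "\<pi> \<in> affine_perms N enc"
    then obtain a b where \<pi>: "\<pi> = f a b" "a \<noteq> 0" unfolding aff by auto
    show "\<pi> permutes {..<N}"
    proof (rule bij_imp_permutes)
      show "bij_betw \<pi> {..<N} {..<N}"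
      proof (rule bij_betwI[where g = "\<lambda>y. dec ((enc y - b) / a)"])
        fix x assume "x \<in> {..<N}"
        then show "dec ((enc (\<pi> x) - b) / a) = x" using \<pi> by (simp add: f_def ed de)
      next
        fix y assume "y \<in> {..<N}"
        then show "\<pi> (dec ((enc y - b) / a)) = y" using \<pi> by (simp add: f_def ed de dec_lt)
      qed (auto simp: \<pi> f_def dec_lt)
    qed (simp add: \<pi> f_def)
  next
    fix x1 x2 y1 y2 assume x: "x1 \<in> {..<N}" "x2 \<in> {..<N}" "y1 \<in> {..<N}" "y2 \<in> {..<N}" "x1 \<noteq> x2" "y1 \<noteq> y2"
    have ne: "enc x1 - enc x2 \<noteq> 0" "enc y1 - enc y2 \<noteq> 0" using x by (auto dest: de) (metis de)+
    define a where "a = (enc y1 - enc y2) / (enc x1 - enc x2)"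
    define b where "b = enc y1 - a * enc x1"
    have "a' * enc x1 + b' = enc y1 \<and> a' * enc x2 + b' = enc y2 \<longleftrightarrow> a' = a \<and> b' = b" for a' b'
    proof
      assume *: "a' * enc x1 + b' = enc y1 \<and> a' * enc x2 + b' = enc y2"
      then have "enc y1 - enc y2 = (a' * enc x1 + b') - (a' * enc x2 + b')" by simp
      also have "\<dots> = a' * (enc x1 - enc x2)" by (simp add: algebra_simps)
      finally have "enc y1 - enc y2 = a' * (enc x1 - enc x2)" .
      then have "a' = a" using ne by (simp add: a_def)
      then show "a' = a \<and> b' = b" using * by (auto simp: b_def algebra_simps)
    next
      have "a * (enc x1 - enc x2) = enc y1 - enc y2" using ne by (simp add: a_def)
      moreover have "a * enc x2 + b = enc y1 - a * (enc x1 - enc x2)"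
        by (simp add: b_def algebra_simps)
      ultimately show "a' = a \<and> b' = b \<Longrightarrow> a' * enc x1 + b' = enc y1 \<and> a' * enc x2 + b' = enc y2"
        by (simp add: b_def)
    qed
    then have char: "f a' b' x1 = y1 \<and> f a' b' x2 = y2 \<longleftrightarrow> a' = a \<and> b' = b" for a' b'
      using x by (simp add: f_eq)
    have "a \<noteq> 0" using ne by (simp add: a_def)
    then have "(\<lambda>(a, b). f a b) (a, b) \<in> affine_perms N enc" unfolding aff by (intro imageI) simp
    moreover have "\<pi> = f a b" if "\<pi> \<in> affine_perms N enc" "\<pi> x1 = y1" "\<pi> x2 = y2" for \<pi>
    proof -
      obtain a' b' where "\<pi> = f a' b'" using \<open>\<pi> \<in> affine_perms N enc\<close> unfolding aff by auto
      then show ?thesis using char[of a' b'] that by simp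
    qed
    ultimately have "{\<pi> \<in> affine_perms N enc. \<pi> x1 = y1 \<and> \<pi> x2 = y2} = {f a b}"
      using char by auto
    moreover have "real (N * (N - 1)) = real N * (real N - 1)" using \<open>N > 0\<close> by simp
    ultimately show "real (card {\<pi> \<in> affine_perms N enc. \<pi> x1 = y1 \<and> \<pi> x2 = y2}) / real (card (affine_perms N enc))
          = 1 / (real (card {..<N}) * (real (card {..<N}) - 1))"
      unfolding card by simp
  qed
qed

section \<open>The error operator of an extractor\<close>

lemma sum_split_index:
  fixes f :: "nat \<Rightarrow> 'a::comm_monoid_add"
  shows "(\<Sum>k<a * b. f k) = (\<Sum>i<a. \<Sum>j<b. f (i * b + j))"
proof (induction a)
  case (Suc a)
  have "{..<Suc a * b} = {..<a * b} \<union> {a * b..<a * b + b}" by auto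
  then have "(\<Sum>k<Suc a * b. f k) = (\<Sum>k<a * b. f k) + (\<Sum>k\<in>{a * b..<a * b + b}. f k)"
    by (simp add: sum.union_disjoint ivl_disj_int_one)
  also have "(\<Sum>k\<in>{a * b..<a * b + b}. f k) = (\<Sum>j<b. f (a * b + j))"
    by (rule sum.reindex_bij_witness[of _ "\<lambda>j. a * b + j" "\<lambda>k. k - a * b"]) auto
  finally show ?case using Suc by simp
qed simp

lemma split_index_less:
  "i < a \<Longrightarrow> j < b \<Longrightarrow> i * b + j < a * (b::nat)"
  by (metis add_less_cancel_left less_le_trans mult_le_mono1 mult_Suc Suc_leI add.commute)

lemma split_indexE:
  assumes "k < a * (b::nat)"
  obtains i j where "i < a" "j < b" "k = i * b + j"
proof (rule that[of "k div b" "k mod b"])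
  show "k div b < a" using assms by (simp add: less_mult_imp_div_less)
  show "k mod b < b" using assms by (cases "b = 0") auto
qed simp

section \<open>Kronecker products and their Hilbert-Schmidt norms\<close>

lemma kron_carrier [simp]:
  "A \<in> carrier_mat a b \<Longrightarrow> B \<in> carrier_mat c d \<Longrightarrow> kron A B \<in> carrier_mat (a * c) (b * d)"
  by (auto simp: kron_def)

lemma kron_index:
  assumes "A \<in> carrier_mat a b" "B \<in> carrier_mat c d" "i < a" "i' < c" "j < b" "j' < d"
  shows "kron A B $$ (i * c + i', j * d + j') = A $$ (i, j) * B $$ (i', j')"
  using assms split_index_less[of i a i' c] split_index_less[of j b j' d] by (auto simp: kron_def)

lemma mat_eq_splitI:
  assumes "A \<in> carrier_mat (a * b) (c * d)" "B \<in> carrier_mat (a * b) (c * d)"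
    and "\<And>i j k l. i < a \<Longrightarrow> j < b \<Longrightarrow> k < c \<Longrightarrow> l < d \<Longrightarrow>
      A $$ (i * b + j, k * d + l) = B $$ (i * b + j, k * d + l)"
  shows "A = B"
proof (rule eq_matI)
  fix i j assume "i < dim_row B" "j < dim_col B"
  then show "A $$ (i, j) = B $$ (i, j)"
    using assms by (auto elim!: split_indexE[of i a b] split_indexE[of j c d])
qed (use assms in auto)

text \<open>The mixed-product rule, used to invert \<open>kron (1\<^sub>m N) L\<close> factor by
  factor.\<close>

lemma kron_mult:
  assumes A: "A \<in> carrier_mat a b" and B: "B \<in> carrier_mat c d"
    and A': "A' \<in> carrier_mat b a'" and B': "B' \<in> carrier_mat d c'"
  shows "kron A B * kron A' B' = kron (A * A') (B * B')"
proof (rule mat_eq_splitI)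
  show "kron A B * kron A' B' \<in> carrier_mat (a * c) (a' * c')"
    by (rule mult_carrier_mat[OF kron_carrier[OF A B] kron_carrier[OF A' B']])
  show "kron (A * A') (B * B') \<in> carrier_mat (a * c) (a' * c')" using assms by simp
  fix i j k l assume ijkl: "i < a" "j < c" "k < a'" "l < c'"
  have "(kron A B * kron A' B') $$ (i * c + j, k * c' + l)
     = (\<Sum>x<b. \<Sum>y<d. A $$ (i, x) * B $$ (j, y) * (A' $$ (x, k) * B' $$ (y, l)))"
    unfolding mult_mat_index[OF kron_carrier[OF A B] kron_carrier[OF A' B']
        split_index_less[OF ijkl(1,2)] split_index_less[OF ijkl(3,4)]] sum_split_index
    using ijkl by (intro sum.cong refl) (simp add: kron_index[OF A B] kron_index[OF A' B'])
  also have "\<dots> = (A * A') $$ (i, k) * (B * B') $$ (j, l)"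
    unfolding mult_mat_index[OF A A' ijkl(1,3)] mult_mat_index[OF B B' ijkl(2,4)]
    by (simp add: sum_product mult_ac)
  also have "\<dots> = kron (A * A') (B * B') $$ (i * c + j, k * c' + l)"
    using ijkl assms by (intro kron_index[symmetric]) auto
  finally show "(kron A B * kron A' B') $$ (i * c + j, k * c' + l)
     = kron (A * A') (B * B') $$ (i * c + j, k * c' + l)" .
qed

lemma kron_one: "kron (1\<^sub>m a) (1\<^sub>m b) = 1\<^sub>m (a * b)"
proof (rule mat_eq_splitI[of _ a b a b])
  fix i j k l assume ijkl: "i < a" "j < b" "k < a" "l < b"
  have "i * b + j = k * b + l \<longleftrightarrow> i = k \<and> j = l"
  proof
    assume eq: "i * b + j = k * b + l"
    have "(i * b + j) div b = i" "(k * b + l) div b = k" using ijkl by auto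
    then show "i = k \<and> j = l" using eq by auto
  qed simp
  then show "kron (1\<^sub>m a) (1\<^sub>m b) $$ (i * b + j, k * b + l) = 1\<^sub>m (a * b) $$ (i * b + j, k * b + l)"
    using ijkl by (subst kron_index) (auto simp: split_index_less)
qed auto

lemma frob_sq_split:
  assumes "A \<in> carrier_mat (a * b) (c * d)"
  shows "frob_sq A = (\<Sum>i<a. \<Sum>j<b. \<Sum>k<c. \<Sum>l<d. (cmod (A $$ (i * b + j, k * d + l)))\<^sup>2)"
  using assms by (simp add: frob_sq_def sum_split_index)

lemma frob_sq_kron:
  assumes A: "A \<in> carrier_mat a b" and B: "B \<in> carrier_mat c d"
  shows "frob_sq (kron A B) = frob_sq A * frob_sq B"
proof -
  have "frob_sq (kron A B) = (\<Sum>i<a. \<Sum>j<c. \<Sum>k<b. \<Sum>l<d. (cmod (A $$ (i, k)))\<^sup>2 * (cmod (B $$ (j, l)))\<^sup>2)"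
    unfolding frob_sq_split[OF kron_carrier[OF A B]]
    by (intro sum.cong refl) (simp add: kron_index[OF A B] norm_mult power_mult_distrib)
  also have "\<dots> = (\<Sum>i<a. \<Sum>k<b. \<Sum>j<c. \<Sum>l<d. (cmod (A $$ (i, k)))\<^sup>2 * (cmod (B $$ (j, l)))\<^sup>2)"
    by (intro sum.cong refl sum.swap)
  also have "\<dots> = (\<Sum>i<a. \<Sum>k<b. (cmod (A $$ (i, k)))\<^sup>2 * frob_sq B)"
    using B by (simp add: frob_sq_def sum_distrib_left)
  also have "\<dots> = frob_sq A * frob_sq B"
    using A by (simp add: frob_sq_def[of A] sum_distrib_right)
  finally show ?thesis .
qed

lemma frob_sq_one: "frob_sq (1\<^sub>m n) = real n"
proof -
  have "frob_sq (1\<^sub>m n) = (\<Sum>i<n. \<Sum>j<n. if j = i then 1 else 0)"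
    unfolding frob_sq_def by (intro sum.cong) auto
  then show ?thesis by simp
qed

section \<open>Factoring the dominating operator on the side information\<close>

lemma psd_shift_factor:
  assumes \<sigma>: "psd r \<sigma>" and \<delta>: "0 < \<delta>"
  obtains L H where "L \<in> carrier_mat r r" "H \<in> carrier_mat r r" "H * L = 1\<^sub>m r"
    "\<forall>s<r. \<forall>t<r.
      (\<Sum>u<r. L $$ (s, u) * cnj (L $$ (t, u))) = \<sigma> $$ (s, t) + (if s = t then of_real \<delta> else 0)"
    "frob_sq L = Re (mat_trace \<sigma>) + real r * \<delta>"
proof -
  obtain w l where w: "eigensystem r r \<sigma> w l" and l: "\<And>k. k < r \<Longrightarrow> 0 \<le> l k"
    using psd_eigensystem[OF \<sigma>] by blast
  have \<sigma>c: "\<sigma> \<in> carrier_mat r r" using \<sigma> by (simp add: psd_def)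
  have on: "orthonormal r r w" using w by (simp add: eigensystem_def)
  \<comment> \<open>The columns of \<open>L\<close> are eigenvectors of \<open>\<sigma>\<close>
    scaled by roots of the shifted eigenvalues. The shift keeps these away from zero even for
    singular \<open>\<sigma>\<close>, so \<open>H\<close> can divide by them.\<close>
  define a where "a u = complex_of_real (sqrt (l u + \<delta>))" for u
  have a: "a u * a u = of_real (l u) + of_real \<delta>" "a u \<noteq> 0" "cnj (a u) = a u" if "u < r" for u
  proof -
    have "complex_of_real (sqrt (l u + \<delta>) * sqrt (l u + \<delta>)) = of_real (l u + \<delta>)"
      using l[OF that] \<delta> by simp
    then show "a u * a u = of_real (l u) + of_real \<delta>" unfolding a_def of_real_mult of_real_add .
    show "a u \<noteq> 0" "cnj (a u) = a u" using l[OF that] \<delta> by (auto simp: a_def)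
  qed
  define L where "L = mat r r (\<lambda>(s, u). w u s * a u)"
  define H where "H = mat r r (\<lambda>(u, s). cnj (w u s) / a u)"
  have L: "L \<in> carrier_mat r r" and H: "H \<in> carrier_mat r r" by (auto simp: L_def H_def)
  have HL: "H * L = 1\<^sub>m r"
  proof (rule eq_matI)
    fix u v assume "u < dim_row (1\<^sub>m r)" "v < dim_col (1\<^sub>m r)"
    then have uv: "u < r" "v < r" by auto
    have "(H * L) $$ (u, v) = (\<Sum>s<r. w v s * cnj (w u s)) * (a v / a u)"
      unfolding mult_mat_index[OF H L uv] sum_distrib_right
      using uv by (intro sum.cong refl) (simp add: L_def H_def)
    also have "\<dots> = 1\<^sub>m r $$ (u, v)"
      using on uv a(2)[OF uv(1)] by (auto simp: orthonormal_def)
    finally show "(H * L) $$ (u, v) = 1\<^sub>m r $$ (u, v)" .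
  qed (use H L in auto)
  have LL: "(\<Sum>u<r. L $$ (s, u) * cnj (L $$ (t, u))) = \<sigma> $$ (s, t) + (if s = t then of_real \<delta> else 0)"
    if st: "s < r" "t < r" for s t
  proof -
    have "(\<Sum>u<r. L $$ (s, u) * cnj (L $$ (t, u)))
        = (\<Sum>u<r. of_real (l u) * w u s * cnj (w u t) + of_real \<delta> * (w u s * cnj (w u t)))"
    proof (intro sum.cong refl)
      fix u assume "u \<in> {..<r}"
      then have u: "u < r" by simp
      have "L $$ (s, u) * cnj (L $$ (t, u)) = (a u * a u) * (w u s * cnj (w u t))"
        using st u by (simp add: L_def a(3) mult_ac)
      then show "L $$ (s, u) * cnj (L $$ (t, u))
          = of_real (l u) * w u s * cnj (w u t) + of_real \<delta> * (w u s * cnj (w u t))"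
        by (simp add: a(1)[OF u] algebra_simps)
    qed
    also have "\<dots> = \<sigma> $$ (s, t) + of_real \<delta> * (\<Sum>u<r. w u s * cnj (w u t))"
      by (simp add: sum.distrib eigensystem_expand[OF \<sigma>c w st] sum_distrib_left)
    finally show ?thesis by (simp add: orthonormal_complete[OF on st])
  qed
  have "complex_of_real (frob_sq L) = (\<Sum>s<r. \<Sum>u<r. L $$ (s, u) * cnj (L $$ (s, u)))"
    using L by (simp add: frob_sq_def sum_mult_cnj)
  also have "\<dots> = mat_trace \<sigma> + of_real (real r * \<delta>)"
    using \<sigma>c by (simp add: LL sum.distrib mat_trace_def)
  finally have "frob_sq L = Re (mat_trace \<sigma>) + real r * \<delta>"
    by (metis Re_complex_of_real plus_complex.simps(1))
  with that[OF L H HL] show ?thesis using LL by blast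
qed

text \<open>For \<open>K = 1 \<otimes> L\<close>, the product of \<open>K\<close> with its adjoint
  is \<open>1 \<otimes> \<sigma> + \<delta>\<close>, which dominates
  \<open>1 \<otimes> \<sigma>\<close>. The conclusion has the shape of the hypothesis
  \<open>le\<close> of \<open>frob_sq_inverse_mult_le\<close>.\<close>

lemma kron_one_dominates:
  assumes \<sigma>: "\<sigma> \<in> carrier_mat r r" and \<rho>: "\<rho> \<in> carrier_mat (N * r) (N * r)"
    and dom: "psd (N * r) (of_real c \<cdot>\<^sub>m kron (1\<^sub>m N) \<sigma> - \<rho>)"
    and c: "0 \<le> c" and \<delta>: "0 \<le> \<delta>" and L: "L \<in> carrier_mat r r"
    and LL: "\<forall>s<r. \<forall>t<r.
      (\<Sum>u<r. L $$ (s, u) * cnj (L $$ (t, u))) = \<sigma> $$ (s, t) + (if s = t then of_real \<delta> else 0)"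
  shows "Re (quad (N * r) \<rho> x) \<le>
    c * (\<Sum>j<N * r. (cmod (\<Sum>i<N * r. cnj (kron (1\<^sub>m N) L $$ (i, j)) * x i))\<^sup>2)"
proof -
  let ?K = "kron (1\<^sub>m N) L" and ?S = "kron (1\<^sub>m N) \<sigma>" and ?n = "N * r"
  define Q where "Q = mat ?n ?n (\<lambda>(i, j). \<Sum>k<?n. ?K $$ (i, k) * cnj (?K $$ (j, k)))"
  have K: "?K \<in> carrier_mat ?n ?n" and S: "?S \<in> carrier_mat ?n ?n" using L \<sigma> by auto
  have Q_eq: "Q = ?S + of_real \<delta> \<cdot>\<^sub>m 1\<^sub>m ?n"
  proof (rule mat_eq_splitI[of _ N r N r])
    fix i s j t assume ij: "i < N" "s < r" "j < N" "t < r"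
    note lt = split_index_less[OF ij(1,2)] split_index_less[OF ij(3,4)]
    have "Q $$ (i * r + s, j * r + t) = (\<Sum>y<N. \<Sum>u<r. ?K $$ (i * r + s, y * r + u) * cnj (?K $$ (j * r + t, y * r + u)))"
      using lt by (simp add: Q_def sum_split_index)
    also have "\<dots> = (\<Sum>y<N. if y = i then (if i = j then \<Sum>u<r. L $$ (s, u) * cnj (L $$ (t, u)) else 0) else 0)"
      using ij by (intro sum.cong refl) (auto simp: kron_index[OF one_carrier_mat L])
    also have "\<dots> = (1\<^sub>m N $$ (i, j)) * \<sigma> $$ (s, t) + of_real \<delta> * ((1\<^sub>m N $$ (i, j)) * (1\<^sub>m r $$ (s, t)))"
      using ij by (simp add: LL)
    also have "\<dots> = (?S + of_real \<delta> \<cdot>\<^sub>m kron (1\<^sub>m N) (1\<^sub>m r)) $$ (i * r + s, j * r + t)"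
      using lt S ij
        carrier_matD[OF kron_carrier[OF one_carrier_mat[of N] one_carrier_mat[of r]]]
      by (simp add: kron_index[OF one_carrier_mat \<sigma>] kron_index[OF one_carrier_mat one_carrier_mat]
          del: index_one_mat)
    finally show "Q $$ (i * r + s, j * r + t) = (?S + of_real \<delta> \<cdot>\<^sub>m 1\<^sub>m ?n) $$ (i * r + s, j * r + t)"
      unfolding kron_one .
  qed (use S in \<open>auto simp: Q_def\<close>)
  have "quad ?n Q x = of_real (\<Sum>j<?n. (cmod (\<Sum>i<?n. cnj (?K $$ (i, j)) * x i))\<^sup>2)"
    by (rule quad_gram[where y = "\<lambda>k i. ?K $$ (i, k)"]) (simp add: Q_def)
  moreover have "quad ?n Q x = quad ?n ?S x + of_real (\<delta> * (\<Sum>i<?n. (cmod (x i))\<^sup>2))"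
  proof -
    have "quad ?n Q x = (\<Sum>i<?n. (\<Sum>j<?n. ?S $$ (i, j) * x j) * cnj (x i)
        + (\<Sum>j<?n. (if j = i then of_real \<delta> * x i else 0)) * cnj (x i))"
      unfolding quad_def Q_eq distrib_right[symmetric] sum.distrib[symmetric] using carrier_matD[OF S]
      by (intro sum.cong refl arg_cong2[of _ _ _ _ "(*)"]) (auto simp: algebra_simps)
    also have "\<dots> = quad ?n ?S x + of_real \<delta> * (\<Sum>i<?n. x i * cnj (x i))"
      by (simp add: sum.distrib quad_def sum_distrib_left mult.assoc)
    finally show ?thesis by (simp only: sum_mult_cnj of_real_mult)
  qed
  moreover have "quad ?n (of_real c \<cdot>\<^sub>m ?S - \<rho>) x = of_real c * quad ?n ?S x - quad ?n \<rho> x"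
  proof -
    have "quad ?n (of_real c \<cdot>\<^sub>m ?S - \<rho>) x
       = (\<Sum>i<?n. (\<Sum>j<?n. of_real c * (?S $$ (i, j) * x j) - \<rho> $$ (i, j) * x j) * cnj (x i))"
      unfolding quad_def using carrier_matD[OF S] carrier_matD[OF \<rho>]
      by (intro sum.cong refl arg_cong2[of _ _ _ _ "(*)"]) (auto simp: algebra_simps)
    then show ?thesis
      by (simp add: quad_def sum_subtractf sum_distrib_left left_diff_distrib mult.assoc)
        (simp add: sum_distrib_left sum_distrib_right mult.assoc)
  qed
  moreover have "0 \<le> Re (quad ?n (of_real c \<cdot>\<^sub>m ?S - \<rho>) x)"
    using dom by (simp add: psd_iff_quad less_eq_complex_def)
  ultimately have "Re (quad ?n \<rho> x) \<le> c * Re (quad ?n ?S x)"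
    and eq: "(\<Sum>j<?n. (cmod (\<Sum>i<?n. cnj (?K $$ (i, j)) * x i))\<^sup>2)
       = Re (quad ?n ?S x) + \<delta> * (\<Sum>i<?n. (cmod (x i))\<^sup>2)"
    by (auto simp: complex_eq_iff)
  moreover have "0 \<le> \<delta> * (\<Sum>i<?n. (cmod (x i))\<^sup>2)"
    using \<delta> by (intro mult_nonneg_nonneg sum_nonneg) auto
  ultimately show ?thesis
    unfolding eq using mult_left_mono[of "Re (quad ?n ?S x)" "Re (quad ?n ?S x) + \<delta> * (\<Sum>i<?n. (cmod (x i))\<^sup>2)" c] c
    by linarith
qed

text \<open>Entry \<open>(s, t)\<close> of the \<open>m\<close>-th diagonal block of the error caused by the single unitary \<open>V\<close>.\<close>

definition deviation :: "nat \<Rightarrow> nat \<Rightarrow> nat \<Rightarrow> (nat \<Rightarrow> nat \<Rightarrow> nat) \<Rightarrow> complex mat \<Rightarrow> nat \<Rightarrow> complex mat \<Rightarrow>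
    nat \<Rightarrow> nat \<Rightarrow> nat \<Rightarrow> complex" where
  "deviation N M Mc lab V r X m s t =
     (\<Sum>m'<Mc. \<Sum>x<N. \<Sum>y<N. V $$ (lab m m', x) * X $$ (x * r + s, y * r + t) * cnj (V $$ (lab m m', y)))
     - (\<Sum>x<N. X $$ (x * r + s, x * r + t)) / of_nat M"

section \<open>Entries of the error operator\<close>

lemma conj_kron_one_index:
  assumes V: "V \<in> carrier_mat N N" and X: "X \<in> carrier_mat (N * r) (N * r)"
    and "n < N" "s < r" "t < r"
  shows "(kron V (1\<^sub>m r) * X * mat_adjoint (kron V (1\<^sub>m r))) $$ (n * r + s, n * r + t)
    = (\<Sum>x<N. \<Sum>y<N. V $$ (n, x) * X $$ (x * r + s, y * r + t) * cnj (V $$ (n, y)))"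
proof -
  let ?W = "kron V (1\<^sub>m r)"
  have W: "?W \<in> carrier_mat (N * r) (N * r)" using V by simp
  note idx = split_index_less[OF assms(3,4)] split_index_less[OF assms(3,5)]
  have WX: "(?W * X) $$ (n * r + s, j) = (\<Sum>x<N. V $$ (n, x) * X $$ (x * r + s, j))" if "j < N * r" for j
  proof -
    have "(?W * X) $$ (n * r + s, j) = (\<Sum>x<N. \<Sum>u<r. if u = s then V $$ (n, x) * X $$ (x * r + s, j) else 0)"
      unfolding mult_mat_index[OF W X idx(1) that] sum_split_index using assms
      by (intro sum.cong refl) (auto simp: kron_index[OF V one_carrier_mat])
    then show ?thesis using assms by simp
  qed
  have "(?W * X * mat_adjoint ?W) $$ (n * r + s, n * r + t)
     = (\<Sum>y<N. \<Sum>u<r. (?W * X) $$ (n * r + s, y * r + u) * mat_adjoint ?W $$ (y * r + u, n * r + t))"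
    unfolding mult_mat_index[OF mult_carrier_mat[OF W X] mat_adjoint_carrier[OF W] idx] sum_split_index ..
  also have "\<dots> = (\<Sum>y<N. \<Sum>u<r. if u = t then (\<Sum>x<N. V $$ (n, x) * X $$ (x * r + s, y * r + t)) * cnj (V $$ (n, y)) else 0)"
    using assms idx carrier_matD[OF W]
    by (intro sum.cong refl)
      (auto simp: WX split_index_less mat_adjoint_index kron_index[OF V one_carrier_mat] simp del: index_mult_mat(1))
  also have "\<dots> = (\<Sum>y<N. \<Sum>x<N. V $$ (n, x) * X $$ (x * r + s, y * r + t) * cnj (V $$ (n, y)))"
    using assms by (simp add: sum_distrib_right)
  finally show ?thesis by (subst sum.swap)
qed

lemma basis_proj_carrier: "basis_proj n x \<in> carrier_mat n n"
  by (simp add: basis_proj_def)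

lemma basis_proj_index:
  "i < n \<Longrightarrow> j < n \<Longrightarrow> basis_proj n x $$ (i, j) = (if i = x \<and> j = x then 1 else 0)"
  by (simp add: basis_proj_def)

lemma block_carrier: "block r x X \<in> carrier_mat r r"
  by (simp add: block_def)

lemma block_index:
  "s < r \<Longrightarrow> t < r \<Longrightarrow> block r x X $$ (s, t) = X $$ (x * r + s, x * r + t)"
  by (simp add: block_def)

lemma meas_map_carrier [simp]: "meas_map M Mc lab r X \<in> carrier_mat (M * r) (M * r)"
  by (simp add: meas_map_def mat_sum_def)

lemma meas_map_index:
  assumes "m < M" "m2 < M" "s < r" "t < r"
  shows "meas_map M Mc lab r X $$ (m * r + s, m2 * r + t)
    = (if m = m2 then \<Sum>m'<Mc. X $$ (lab m m' * r + s, lab m m' * r + t) else 0)"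
proof -
  have "meas_map M Mc lab r X $$ (m * r + s, m2 * r + t)
     = (\<Sum>a<M. \<Sum>m'<Mc. kron (basis_proj M a) (block r (lab a m') X) $$ (m * r + s, m2 * r + t))"
    using assms by (simp add: meas_map_def mat_sum_def split_index_less sum.cartesian_product case_prod_unfold)
  also have "\<dots> = (\<Sum>a<M. if a = m then (if m = m2 then \<Sum>m'<Mc. X $$ (lab m m' * r + s, lab m m' * r + t) else 0) else 0)"
    using assms by (intro sum.cong refl) (auto simp: kron_index[OF basis_proj_carrier block_carrier] basis_proj_index block_index)
  finally show ?thesis using assms by simp
qed

lemma extractor_output_carrier [simp]:
  "extractor_output M Mc lab D V r X \<in> carrier_mat (M * r * D) (M * r * D)"
  by (simp add: extractor_output_def mat_sum_def)

lemma ideal_output_carrier [simp]: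
  "ideal_output N M D r X \<in> carrier_mat (M * r * D) (M * r * D)"
  unfolding ideal_output_def ptrace_fst_def mat_sum_def
  by (intro kron_carrier smult_carrier_mat one_carrier_mat mat_carrier)

text \<open>Measurement and seed register make both outputs block diagonal in \<open>m\<close> and
  in \<open>i\<close>, so only the deviations on the diagonal blocks survive, each with the weight
  \<open>1/D\<close> of its seed.\<close>

lemma extractor_error_index:
  assumes V: "\<And>i. i < D \<Longrightarrow> V i \<in> carrier_mat N N" and X: "X \<in> carrier_mat (N * r) (N * r)"
    and lab: "\<And>m m'. m < M \<Longrightarrow> m' < Mc \<Longrightarrow> lab m m' < N"
    and idx: "m < M" "s < r" "i < D" "m2 < M" "t < r" "i2 < D"
  shows "(extractor_output M Mc lab D V r X - ideal_output N M D r X)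
      $$ ((m * r + s) * D + i, (m2 * r + t) * D + i2)
    = (if m = m2 \<and> i = i2 then deviation N M Mc lab (V i) r X m s t / of_nat D else 0)"
proof -
  let ?Y = "\<lambda>i. meas_map M Mc lab r (kron (V i) (1\<^sub>m r) * X * mat_adjoint (kron (V i) (1\<^sub>m r)))"
  note ms = split_index_less[OF idx(1,2)] split_index_less[OF idx(4,5)]
  note msi = split_index_less[OF ms(1) idx(3)] split_index_less[OF ms(2) idx(6)]
  have "extractor_output M Mc lab D V r X $$ ((m * r + s) * D + i, (m2 * r + t) * D + i2)
    = 1 / of_nat D * (\<Sum>a<D. kron (?Y a) (basis_proj D a) $$ ((m * r + s) * D + i, (m2 * r + t) * D + i2))"
    using msi by (simp add: extractor_output_def mat_sum_def)
  also have "\<dots> = 1 / of_nat D * (\<Sum>a<D. if a = i then (if i = i2 then ?Y i $$ (m * r + s, m2 * r + t) else 0) else 0)"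
    using idx ms
    by (intro arg_cong2[of _ _ _ _ "(*)"] sum.cong refl)
      (auto simp: kron_index[OF meas_map_carrier basis_proj_carrier] basis_proj_index)
  also have "\<dots> = 1 / of_nat D * (if i = i2 then (if m = m2 then
      \<Sum>m'<Mc. \<Sum>x<N. \<Sum>y<N. V i $$ (lab m m', x) * X $$ (x * r + s, y * r + t) * cnj (V i $$ (lab m m', y)) else 0) else 0)"
    using idx lab by (simp add: meas_map_index conj_kron_one_index[OF V X])
  finally have out: "extractor_output M Mc lab D V r X $$ ((m * r + s) * D + i, (m2 * r + t) * D + i2) = \<dots>" .
  have pt: "ptrace_fst N r X \<in> carrier_mat r r" by (simp add: ptrace_fst_def mat_sum_def)
  have oM: "(1 / of_nat M) \<cdot>\<^sub>m 1\<^sub>m M \<in> carrier_mat M M" and oD: "(1 / of_nat D) \<cdot>\<^sub>m 1\<^sub>m D \<in> carrier_mat D D"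
    by auto
  have "ideal_output N M D r X $$ ((m * r + s) * D + i, (m2 * r + t) * D + i2)
     = ((1 / of_nat M) \<cdot>\<^sub>m 1\<^sub>m M) $$ (m, m2) * ptrace_fst N r X $$ (s, t) * ((1 / of_nat D) \<cdot>\<^sub>m 1\<^sub>m D) $$ (i, i2)"
    unfolding ideal_output_def kron_index[OF kron_carrier[OF oM pt] oD ms(1) idx(3) ms(2) idx(6)]
      kron_index[OF oM pt idx(1,2,4,5)] ..
  also have "\<dots> = (if m = m2 \<and> i = i2 then (\<Sum>x<N. X $$ (x * r + s, x * r + t)) / of_nat M / of_nat D else 0)"
    using idx by (simp add: ptrace_fst_def mat_sum_def block_def)
  finally have "ideal_output N M D r X $$ ((m * r + s) * D + i, (m2 * r + t) * D + i2) = \<dots>" .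
  then show ?thesis
    using msi out carrier_matD[OF ideal_output_carrier[of N M D r X]]
    by (simp add: deviation_def diff_divide_distrib)
qed

text \<open>Conjugation by \<open>V i\<close>, measurement and partial trace leave the side
  information alone, so a factor \<open>L\<close> acting there from the left passes through all of
  them. This provides the product to which Hoelder's inequality is applied.\<close>

lemma extractor_error_factor:
  assumes V: "\<And>i. i < D \<Longrightarrow> V i \<in> carrier_mat N N" and X: "X \<in> carrier_mat (N * r) (N * r)"
    and L: "L \<in> carrier_mat r r"
    and lab: "\<And>m m'. m < M \<Longrightarrow> m' < Mc \<Longrightarrow> lab m m' < N"
  defines "err \<equiv> \<lambda>X. extractor_output M Mc lab D V r X - ideal_output N M D r X"
  shows "err (kron (1\<^sub>m N) L * X) = kron (kron (1\<^sub>m M) L) (1\<^sub>m D) * err X"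
proof (rule mat_eq_splitI[of _ "M * r" D "M * r" D])
  let ?K = "kron (kron (1\<^sub>m M) L) (1\<^sub>m D)" and ?n = "M * r * D"
  have KM: "kron (1\<^sub>m M) L \<in> carrier_mat (M * r) (M * r)" using L by simp
  have K: "?K \<in> carrier_mat ?n ?n" using KM by simp
  have err: "err Y \<in> carrier_mat ?n ?n" for Y unfolding err_def by (intro minus_carrier_mat) simp
  show "err (kron (1\<^sub>m N) L * X) \<in> carrier_mat ?n ?n" by (rule err)
  show "?K * err X \<in> carrier_mat ?n ?n" using K err by (rule mult_carrier_mat)
  fix p i p2 i2 assume "p < M * r" "p2 < M * r" and i: "i < D" "i2 < D"
  then obtain m s m2 t where p: "p = m * r + s" "p2 = m2 * r + t" and idx: "m < M" "s < r" "m2 < M" "t < r"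
    by (metis split_indexE)
  note ms = split_index_less[OF idx(1,2)] split_index_less[OF idx(3,4)]
  have NL: "kron (1\<^sub>m N) L \<in> carrier_mat (N * r) (N * r)" using L by simp
  have LX: "(kron (1\<^sub>m N) L * X) $$ (x * r + s, y * r + t) = (\<Sum>u<r. L $$ (s, u) * X $$ (x * r + u, y * r + t))"
    if "x < N" "y < N" for x y
  proof -
    have "(kron (1\<^sub>m N) L * X) $$ (x * r + s, y * r + t)
        = (\<Sum>z<N. if z = x then \<Sum>u<r. L $$ (s, u) * X $$ (x * r + u, y * r + t) else 0)"
      unfolding mult_mat_index[OF NL X split_index_less[OF that(1) idx(2)] split_index_less[OF that(2) idx(4)]]
        sum_split_index
      using that idx by (intro sum.cong refl) (auto simp: kron_index[OF one_carrier_mat L])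
    then show ?thesis using that by simp
  qed
  \<comment> \<open>The deviation is linear in the operator, and the row index \<open>s\<close> of
    the side information is a mere parameter in it; the mixing of rows by \<open>L\<close> can
    therefore be pulled out.\<close>
  have dev: "deviation N M Mc lab W r (kron (1\<^sub>m N) L * X) m s t = (\<Sum>u<r. L $$ (s, u) * deviation N M Mc lab W r X m u t)" for W
  proof -
    have "(\<Sum>x<N. \<Sum>y<N. W $$ (n, x) * (kron (1\<^sub>m N) L * X) $$ (x * r + s, y * r + t) * cnj (W $$ (n, y)))
       = (\<Sum>u<r. L $$ (s, u) * (\<Sum>x<N. \<Sum>y<N. W $$ (n, x) * X $$ (x * r + u, y * r + t) * cnj (W $$ (n, y))))" for n
    proof -
      have "(\<Sum>x<N. \<Sum>y<N. W $$ (n, x) * (kron (1\<^sub>m N) L * X) $$ (x * r + s, y * r + t) * cnj (W $$ (n, y)))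
        = (\<Sum>x<N. \<Sum>y<N. \<Sum>u<r. L $$ (s, u) * (W $$ (n, x) * X $$ (x * r + u, y * r + t) * cnj (W $$ (n, y))))"
        by (intro sum.cong refl) (simp add: LX sum_distrib_left sum_distrib_right mult_ac del: index_mult_mat(1))
      also have "\<dots> = (\<Sum>x<N. \<Sum>u<r. \<Sum>y<N. L $$ (s, u) * (W $$ (n, x) * X $$ (x * r + u, y * r + t) * cnj (W $$ (n, y))))"
        by (intro sum.cong refl sum.swap)
      also have "\<dots> = (\<Sum>u<r. \<Sum>x<N. \<Sum>y<N. L $$ (s, u) * (W $$ (n, x) * X $$ (x * r + u, y * r + t) * cnj (W $$ (n, y))))"
        by (rule sum.swap)
      finally show ?thesis by (simp only: sum_distrib_left)
    qed
    then have "(\<Sum>m'<Mc. \<Sum>x<N. \<Sum>y<N. W $$ (lab m m', x) * (kron (1\<^sub>m N) L * X) $$ (x * r + s, y * r + t) * cnj (W $$ (lab m m', y)))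
      = (\<Sum>u<r. L $$ (s, u) * (\<Sum>m'<Mc. \<Sum>x<N. \<Sum>y<N. W $$ (lab m m', x) * X $$ (x * r + u, y * r + t) * cnj (W $$ (lab m m', y))))"
      by (simp only: sum_distrib_left) (rule sum.swap)
    moreover have "(\<Sum>x<N. (kron (1\<^sub>m N) L * X) $$ (x * r + s, x * r + t))
      = (\<Sum>u<r. L $$ (s, u) * (\<Sum>x<N. X $$ (x * r + u, x * r + t)))"
    proof -
      have "(\<Sum>x<N. (kron (1\<^sub>m N) L * X) $$ (x * r + s, x * r + t))
         = (\<Sum>x<N. \<Sum>u<r. L $$ (s, u) * X $$ (x * r + u, x * r + t))"
        by (intro sum.cong refl) (simp add: LX del: index_mult_mat(1))
      also have "\<dots> = (\<Sum>u<r. \<Sum>x<N. L $$ (s, u) * X $$ (x * r + u, x * r + t))" by (rule sum.swap)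
      finally show ?thesis by (simp only: sum_distrib_left)
    qed
    moreover have "(\<Sum>u<r. L $$ (s, u) * g u) / of_nat M = (\<Sum>u<r. L $$ (s, u) * (g u / of_nat M))" for g
      by (simp add: sum_divide_distrib)
    ultimately show ?thesis
      unfolding deviation_def by (simp only: right_diff_distrib sum_subtractf)
  qed
  have "(?K * err X) $$ (p * D + i, p2 * D + i2)
     = (\<Sum>a<M. \<Sum>u<r. \<Sum>j<D. ?K $$ ((m * r + s) * D + i, (a * r + u) * D + j) * err X $$ ((a * r + u) * D + j, (m2 * r + t) * D + i2))"
    unfolding p mult_mat_index[OF K err split_index_less[OF ms(1) i(1)] split_index_less[OF ms(2) i(2)]] sum_split_index ..
  also have "\<dots> = (\<Sum>a<M. \<Sum>u<r. \<Sum>j<D. if a = m then if j = i then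
      L $$ (s, u) * err X $$ ((m * r + u) * D + i, (m2 * r + t) * D + i2) else 0 else 0)"
    using idx i ms
    by (intro sum.cong refl)
      (auto simp: kron_index[OF KM one_carrier_mat] kron_index[OF one_carrier_mat L] split_index_less)
  also have "\<dots> = (\<Sum>a<M. if a = m then \<Sum>u<r. \<Sum>j<D. if j = i then
      L $$ (s, u) * err X $$ ((m * r + u) * D + i, (m2 * r + t) * D + i2) else 0 else 0)"
    by (intro sum.cong refl) auto
  also have "\<dots> = (\<Sum>u<r. L $$ (s, u) * err X $$ ((m * r + u) * D + i, (m2 * r + t) * D + i2))"
    using idx i by simp
  also have "\<dots> = (\<Sum>u<r. L $$ (s, u) * (if m = m2 \<and> i = i2 then deviation N M Mc lab (V i) r X m u t / of_nat D else 0))"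
    unfolding err_def using idx i
    by (intro sum.cong refl) (simp add: extractor_error_index[OF V X lab] del: index_minus_mat)
  also have "\<dots> = (if m = m2 \<and> i = i2 then deviation N M Mc lab (V i) r (kron (1\<^sub>m N) L * X) m s t / of_nat D else 0)"
    unfolding dev by (cases "m = m2 \<and> i = i2") (auto simp: sum_divide_distrib)
  also have "\<dots> = err (kron (1\<^sub>m N) L * X) $$ (p * D + i, p2 * D + i2)"
    unfolding err_def p using idx i
    by (subst extractor_error_index[OF V mult_carrier_mat[OF NL X] lab]) simp_all
  finally show "err (kron (1\<^sub>m N) L * X) $$ (p * D + i, p2 * D + i2) = (?K * err X) $$ (p * D + i, p2 * D + i2)" ..
qed

text \<open>The side-information indices come first because the moment bound below holds for each
  fixed pair of them.\<close>

lemma frob_sq_extractor_error: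
  assumes V: "\<And>i. i < D \<Longrightarrow> V i \<in> carrier_mat N N" and X: "X \<in> carrier_mat (N * r) (N * r)"
    and lab: "\<And>m m'. m < M \<Longrightarrow> m' < Mc \<Longrightarrow> lab m m' < N"
  shows "frob_sq (extractor_output M Mc lab D V r X - ideal_output N M D r X)
    = (\<Sum>s<r. \<Sum>t<r. \<Sum>i<D. \<Sum>m<M. (cmod (deviation N M Mc lab (V i) r X m s t))\<^sup>2) / (real D)\<^sup>2"
proof -
  let ?E = "extractor_output M Mc lab D V r X - ideal_output N M D r X"
  let ?d = "\<lambda>m s t i. (cmod (deviation N M Mc lab (V i) r X m s t))\<^sup>2 / (real D)\<^sup>2"
  have E: "?E \<in> carrier_mat (M * r * D) (M * r * D)" by (intro minus_carrier_mat) simp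
  have "frob_sq ?E = (\<Sum>m<M. \<Sum>s<r. \<Sum>i<D. \<Sum>m2<M. \<Sum>t<r. \<Sum>i2<D.
      (cmod (?E $$ ((m * r + s) * D + i, (m2 * r + t) * D + i2)))\<^sup>2)"
    unfolding frob_sq_split[OF E] sum_split_index ..
  also have "\<dots> = (\<Sum>m<M. \<Sum>s<r. \<Sum>i<D. \<Sum>m2<M. \<Sum>t<r. \<Sum>i2<D.
      if m2 = m then if i2 = i then ?d m s t i else 0 else 0)"
    by (intro sum.cong refl)
      (auto simp: extractor_error_index[OF V X lab] norm_divide power_divide simp del: index_minus_mat)
  also have "\<dots> = (\<Sum>m<M. \<Sum>s<r. \<Sum>i<D. \<Sum>m2<M.
      if m2 = m then \<Sum>t<r. \<Sum>i2<D. if i2 = i then ?d m s t i else 0 else 0)"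
    by (intro sum.cong refl) auto
  also have "\<dots> = (\<Sum>m<M. \<Sum>s<r. \<Sum>i<D. \<Sum>t<r. ?d m s t i)" by simp
  also have "\<dots> = (\<Sum>s<r. \<Sum>m<M. \<Sum>i<D. \<Sum>t<r. ?d m s t i)" by (rule sum.swap)
  also have "\<dots> = (\<Sum>s<r. \<Sum>m<M. \<Sum>t<r. \<Sum>i<D. ?d m s t i)" by (intro sum.cong refl sum.swap)
  also have "\<dots> = (\<Sum>s<r. \<Sum>t<r. \<Sum>m<M. \<Sum>i<D. ?d m s t i)" by (intro sum.cong refl sum.swap)
  also have "\<dots> = (\<Sum>s<r. \<Sum>t<r. \<Sum>i<D. \<Sum>m<M. ?d m s t i)" by (intro sum.cong refl sum.swap)
  finally show ?thesis by (simp only: sum_divide_distrib)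
qed

section \<open>The extractor property\<close>

lemma perm_op_index:
  assumes \<pi>: "\<pi> permutes {..<N}" and ij: "i < N" "j < N"
  shows "perm_op N \<pi> $$ (i, j) = (if j = inv_into UNIV \<pi> i then 1 else 0)"
proof -
  have "i = \<pi> j \<longleftrightarrow> j = inv_into UNIV \<pi> i" using \<pi> by (metis permutes_inverses)
  then show ?thesis using ij by (simp add: perm_op_def)
qed

text \<open>The operator sends basis vector \<open>n\<close> to \<open>\<pi> n\<close>, so rows are
  read at preimages; this is why the moment bounds evaluate at
  \<open>inv_into UNIV \<pi>\<close>.\<close>

lemma perm_op_mult_index:
  assumes \<pi>: "\<pi> permutes {..<N}" and U: "U \<in> carrier_mat N N" and ix: "i < N" "x < N"
  shows "(perm_op N \<pi> * U) $$ (i, x) = U $$ (inv_into UNIV \<pi> i, x)"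
proof -
  have c: "perm_op N \<pi> \<in> carrier_mat N N" by (simp add: perm_op_def)
  have "inv_into UNIV \<pi> i < N" using permutes_in_image[OF permutes_inv[OF \<pi>], of i] ix by simp
  moreover have "(perm_op N \<pi> * U) $$ (i, x) = (\<Sum>j<N. if j = inv_into UNIV \<pi> i then U $$ (inv_into UNIV \<pi> i, x) else 0)"
    unfolding mult_mat_index[OF c U ix] using ix by (intro sum.cong refl) (auto simp: perm_op_index[OF \<pi>])
  ultimately show ?thesis by simp
qed

lemma unitary_matI:
  assumes U: "U \<in> carrier_mat N N"
    and row: "\<And>i j. i < N \<Longrightarrow> j < N \<Longrightarrow> (\<Sum>x<N. U $$ (i, x) * cnj (U $$ (j, x))) = (if i = j then 1 else 0)"
  shows "unitary_mat N U"
proof -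
  note A = mat_adjoint_carrier[OF U]
  have "U * mat_adjoint U = 1\<^sub>m N"
  proof (rule eq_matI)
    fix i j assume "i < dim_row (1\<^sub>m N)" "j < dim_col (1\<^sub>m N)"
    then have ij: "i < N" "j < N" by auto
    have "(U * mat_adjoint U) $$ (i, j) = (\<Sum>x<N. U $$ (i, x) * cnj (U $$ (j, x)))"
      unfolding mult_mat_index[OF U A ij] using U ij
      by (intro sum.cong refl) (simp add: mat_adjoint_index)
    then show "(U * mat_adjoint U) $$ (i, j) = 1\<^sub>m N $$ (i, j)" using ij row by simp
  qed (use U A in auto)
  then show ?thesis using mat_mult_left_right_inverse[OF U A] U by (simp add: unitary_mat_def)
qed

lemma unitary_mat_perm_op_mult:
  assumes \<pi>: "\<pi> permutes {..<N}" and U: "unitary_mat N U"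
  shows "unitary_mat N (perm_op N \<pi> * U)"
proof (rule unitary_matI)
  have Uc: "U \<in> carrier_mat N N" using U by (simp add: unitary_mat_def)
  have "perm_op N \<pi> \<in> carrier_mat N N" by (simp add: perm_op_def)
  then show "perm_op N \<pi> * U \<in> carrier_mat N N" using Uc by (rule mult_carrier_mat)
  fix i j assume ij: "i < N" "j < N"
  have lt: "inv_into UNIV \<pi> i < N" if "i < N" for i
    using permutes_in_image[OF permutes_inv[OF \<pi>], of i] that by simp
  have "inv_into UNIV \<pi> i = inv_into UNIV \<pi> j \<longleftrightarrow> i = j"
    using permutes_inj[OF permutes_inv[OF \<pi>]] by (auto dest: injD)
  then show "(\<Sum>x<N. (perm_op N \<pi> * U) $$ (i, x) * cnj ((perm_op N \<pi> * U) $$ (j, x))) = (if i = j then 1 else 0)"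
    using ij lt by (simp add: perm_op_mult_index[OF \<pi> Uc] unitary_mat_row[OF U] del: index_mult_mat(1))
qed

text \<open>Fixing \<open>s\<close> and \<open>t\<close> leaves an arbitrary operator
  \<open>X'\<close> on the input space. A deviation is then a sum of centred diagonal entries
  \<open>q \<theta>\<close> over the preimages of the labels merged into \<open>m\<close>. Summing
  over permutations first, for each \<open>\<theta>\<close>, and then over all bases by Bessel's
  inequality gives the bound.\<close>

lemma perm_mub_deviation_moment:
  assumes N: "0 < N" and mub: "full_mub N B U" and lab: "tensor_labelling N M Mc lab"
    and PP: "pairwise_independent {..<N} PP" and P: "bij_betw P {..<card PP} PP"
  shows "(\<Sum>i<card PP * (N + 1). \<Sum>m<M.
      (cmod (deviation N M Mc lab (perm_mub_unitary N P U i) r X m s t))\<^sup>2)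
    \<le> real (card PP) * (\<Sum>x<N. \<Sum>y<N. (cmod (X $$ (x * r + s, y * r + t)))\<^sup>2)"
proof -
  define X' where "X' x y = X $$ (x * r + s, y * r + t)" for x y
  define p where "p \<theta> n = (\<Sum>x<N. \<Sum>y<N. U \<theta> $$ (n, x) * X' x y * cnj (U \<theta> $$ (n, y)))" for \<theta> n
  define q where "q \<theta> n = p \<theta> n - (\<Sum>x<N. X' x x) / of_nat N" for \<theta> n
  have U: "unitary_mat N (U \<theta>)" if "\<theta> < N + 1" for \<theta>
    using mub that by (simp add: full_mub_def)
  have Uc: "U \<theta> \<in> carrier_mat N N" if "\<theta> < N + 1" for \<theta>
    using U[OF that] by (simp add: unitary_mat_def)
  have labij: "bij_betw (\<lambda>(m, m'). lab m m') ({..<M} \<times> {..<Mc}) {..<N}"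
    using lab by (simp add: tensor_labelling_def)
  have lt: "lab m m' < N" if "m < M" "m' < Mc" for m m'
    using labij that by (auto simp: bij_betw_def)
  have NM: "N = M * Mc" using bij_betw_same_card[OF labij] by simp
  have perm: "P j permutes {..<N}" if "j < card PP" for j
    using PP P that by (auto simp: pairwise_independent_def bij_betw_def)
  have q0: "(\<Sum>n<N. q \<theta> n) = 0" if "\<theta> < N + 1" for \<theta>
    unfolding q_def p_def
    by (rule unbiased_bessel(1)[of N "{..<N + 1}" "\<lambda>\<theta> n x. U \<theta> $$ (n, x)"])
      (use N that in \<open>auto simp: unitary_mat_row[OF U] unitary_mat_col[OF U] full_mub_overlap[OF mub]\<close>)
  have qsum: "(\<Sum>\<theta><N + 1. \<Sum>n<N. (cmod (q \<theta> n))\<^sup>2) \<le> (\<Sum>x<N. \<Sum>y<N. (cmod (X' x y))\<^sup>2)"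
    unfolding q_def p_def
    by (rule unbiased_bessel(2)[of N "{..<N + 1}" "\<lambda>\<theta> n x. U \<theta> $$ (n, x)"])
      (use N in \<open>auto simp: unitary_mat_row[OF U] unitary_mat_col[OF U] full_mub_overlap[OF mub]\<close>)
  have dev: "deviation N M Mc lab (perm_op N \<pi> * U \<theta>) r X m s t = (\<Sum>m'<Mc. q \<theta> (inv_into UNIV \<pi> (lab m m')))"
    if \<pi>: "\<pi> permutes {..<N}" and \<theta>: "\<theta> < N + 1" and m: "m < M" for \<pi> \<theta> m
  proof -
    have "(\<Sum>m'<Mc. \<Sum>x<N. \<Sum>y<N. (perm_op N \<pi> * U \<theta>) $$ (lab m m', x) * X $$ (x * r + s, y * r + t)
          * cnj ((perm_op N \<pi> * U \<theta>) $$ (lab m m', y)))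
      = (\<Sum>m'<Mc. p \<theta> (inv_into UNIV \<pi> (lab m m')))"
      unfolding p_def X'_def using m lt
      by (intro sum.cong refl) (simp add: perm_op_mult_index[OF \<pi> Uc[OF \<theta>]] del: index_mult_mat(1))
    \<comment> \<open>As \<open>N = M * Mc\<close>, the ideal share \<open>1/M\<close> of the trace
      splits into \<open>Mc\<close> shares \<open>1/N\<close>, one for each label merged into
      \<open>m\<close>.\<close>
    moreover have "(\<Sum>x<N. X' x x) / of_nat M = of_nat Mc * ((\<Sum>x<N. X' x x) / of_nat N)"
      using NM N by (simp add: field_simps)
    ultimately show ?thesis by (simp add: deviation_def q_def sum_subtractf X'_def)
  qed
  have "(\<Sum>i<card PP * (N + 1). \<Sum>m<M.
      (cmod (deviation N M Mc lab (perm_mub_unitary N P U i) r X m s t))\<^sup>2)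
    = (\<Sum>j<card PP. \<Sum>\<theta><N + 1. \<Sum>m<M. (cmod (\<Sum>m'<Mc. q \<theta> (inv_into UNIV (P j) (lab m m'))))\<^sup>2)"
    unfolding sum_split_index
  proof (intro sum.cong refl)
    fix j \<theta> m assume "j \<in> {..<card PP}" "\<theta> \<in> {..<N + 1}" "m \<in> {..<M}"
    then have *: "j < card PP" "\<theta> < N + 1" "m < M" by auto
    have "(j * b + \<theta>) div b = j" "(j * b + \<theta>) mod b = \<theta>" if "\<theta> < b" for b
      using that by auto
    from this[OF *(2)] have "(j * (N + 1) + \<theta>) div (N + 1) = j" "(j * (N + 1) + \<theta>) mod (N + 1) = \<theta>" .
    then have "perm_mub_unitary N P U (j * (N + 1) + \<theta>) = perm_op N (P j) * U \<theta>"
      unfolding perm_mub_unitary_def by metis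
    then show "(cmod (deviation N M Mc lab (perm_mub_unitary N P U (j * (N + 1) + \<theta>)) r X m s t))\<^sup>2
      = (cmod (\<Sum>m'<Mc. q \<theta> (inv_into UNIV (P j) (lab m m'))))\<^sup>2"
      using dev[OF perm *(2,3)] * by simp
  qed
  also have "\<dots> = (\<Sum>\<theta><N + 1. \<Sum>j<card PP. \<Sum>m<M. (cmod (\<Sum>m'<Mc. q \<theta> (inv_into UNIV (P j) (lab m m'))))\<^sup>2)"
    by (rule sum.swap)
  also have "\<dots> = (\<Sum>\<theta><N + 1. \<Sum>\<pi>\<in>PP. \<Sum>m<M. (cmod (\<Sum>m'<Mc. q \<theta> (inv_into UNIV \<pi> (lab m m'))))\<^sup>2)"
    by (intro sum.cong refl sum.reindex_bij_betw[OF P])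
  also have "\<dots> \<le> (\<Sum>\<theta><N + 1. real (card PP) * (\<Sum>n<N. (cmod (q \<theta> n))\<^sup>2))"
    using q0 by (intro sum_mono pairwise_independent_second_moment[OF _ PP labij]) auto
  also have "\<dots> \<le> real (card PP) * (\<Sum>x<N. \<Sum>y<N. (cmod (X' x y))\<^sup>2)"
    unfolding sum_distrib_left[symmetric] by (intro mult_left_mono qsum) simp
  finally show ?thesis by (simp add: X'_def)
qed

section \<open>From the min-entropy bound to the final estimate\<close>

lemma Hmin_witness:
  assumes "ereal k \<le> Hmin N r \<rho>" "- k < b"
  obtains \<sigma> \<mu> where "density r \<sigma>" "\<mu> < b"
    "psd (N * r) (complex_of_real (2 powr \<mu>) \<cdot>\<^sub>m kron (1\<^sub>m N) \<sigma> - \<rho>)"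
proof -
  let ?S = "\<lambda>\<sigma>. {\<mu>::real. psd (N * r) (complex_of_real (2 powr \<mu>) \<cdot>\<^sub>m kron (1\<^sub>m N) \<sigma> - \<rho>)}"
  have "(INF \<sigma>\<in>{\<sigma>. density r \<sigma>}. INF \<mu>\<in>?S \<sigma>. ereal \<mu>) \<le> ereal (- k)"
    using assms(1) unfolding Hmin_def by (metis ereal_minus_le_minus ereal_uminus_uminus uminus_ereal.simps(1))
  \<comment> \<open>Only a strict upper bound on an infimum yields a witness, hence the room between
    \<open>-k\<close> and \<open>b\<close>.\<close>
  also have "\<dots> < ereal b" using assms(2) by simp
  finally obtain \<sigma> where "density r \<sigma>" "(INF \<mu>\<in>?S \<sigma>. ereal \<mu>) < ereal b"
    by (auto simp: INF_less_iff)
  then show ?thesis using that by (auto simp: INF_less_iff)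
qed

text \<open>The squared Hilbert-Schmidt norms of the two Hoelder factors are
  \<open>2 * M * D\<close> and at most \<open>2 powr \<mu> / (D * (N + 1))\<close> with
  \<open>\<mu> < 1 - k\<close>. Their product is at most
  \<open>4 * M * 2 powr (-k) / (N + 1)\<close>, which the bound on \<open>M\<close> brings below
  \<open>\<epsilon>\<^sup>2\<close>.\<close>

lemma perm_mub_extractor:
  assumes N: "0 < N" and mub: "full_mub N B U" and lab: "tensor_labelling N M Mc lab"
    and k: "- log 2 (real N) \<le> k" "k \<le> log 2 (real N)" and \<epsilon>: "0 < \<epsilon>"
    and M: "log 2 (real M) \<le> log 2 (real N) + k - 2 * log 2 (1 / \<epsilon>) - 2"
    and PP: "pairwise_independent {..<N} PP" and P: "bij_betw P {..<card PP} PP"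
  shows "strong_qc_extractor N M Mc lab k \<epsilon> (card PP * (N + 1)) (perm_mub_unitary N P U)"
proof -
  define D where "D = card PP * (N + 1)"
  define V where "V = perm_mub_unitary N P U"
  have cardP: "0 < card PP" using PP by (auto simp: pairwise_independent_def card_gt_0_iff)
  then have D0: "0 < D" by (simp add: D_def)
  have labij: "bij_betw (\<lambda>(m, m'). lab m m') ({..<M} \<times> {..<Mc}) {..<N}"
    using lab by (simp add: tensor_labelling_def)
  have lt: "lab m m' < N" if "m < M" "m' < Mc" for m m'
    using labij that by (auto simp: bij_betw_def)
  have "N = M * Mc" using bij_betw_same_card[OF labij] by simp
  then have M0: "0 < M" using N by simp
  have V: "unitary_mat N (V i)" if "i < D" for i
  proof -
    have "i div (N + 1) < card PP" using that unfolding D_def by (rule less_mult_imp_div_less)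
    then have "P (i div (N + 1)) permutes {..<N}"
      using PP P by (auto simp: pairwise_independent_def bij_betw_def)
    moreover have "unitary_mat N (U (i mod (N + 1)))" using mub by (simp add: full_mub_def)
    ultimately show ?thesis unfolding V_def perm_mub_unitary_def by (rule unitary_mat_perm_op_mult)
  qed
  then have Vc: "V i \<in> carrier_mat N N" if "i < D" for i using that by (simp add: unitary_mat_def)
  \<comment> \<open>The output size bound in exponential form; its summand \<open>-2\<close> becomes
    the divisor \<open>4\<close>.\<close>
  have "real M \<le> 2 powr (log 2 (real N) + k - 2 * log 2 (1 / \<epsilon>) - 2)"
    using M M0 by (simp add: powr_le_iff log_le_iff[symmetric] le_powr_iff)
  also have "\<dots> = real N * 2 powr k * \<epsilon>\<^sup>2 / 4"
  proof -
    have "2 * log 2 (1 / \<epsilon>) = - log 2 (\<epsilon>\<^sup>2)" using \<epsilon> by (simp add: log_divide log_nat_power)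
    then show ?thesis using N \<epsilon> by (simp add: powr_add powr_diff powr_numeral)
  qed
  finally have Mle: "4 * real M \<le> real N * 2 powr k * \<epsilon>\<^sup>2" by simp
  have main: "trace_norm (extractor_output M Mc lab D V r \<rho> - ideal_output N M D r \<rho>) \<le> \<epsilon>"
    if \<rho>: "density (N * r) \<rho>" and H: "ereal k \<le> Hmin N r \<rho>" for r \<rho>
  proof -
    obtain \<sigma> \<mu> where \<sigma>: "density r \<sigma>" and \<mu>: "\<mu> < 1 - k"
      and dom: "psd (N * r) (complex_of_real (2 powr \<mu>) \<cdot>\<^sub>m kron (1\<^sub>m N) \<sigma> - \<rho>)"
      using Hmin_witness[OF H, of "1 - k"] by auto
    have psd\<rho>: "psd (N * r) \<rho>" and tr\<rho>: "mat_trace \<rho> = 1" using \<rho> by (auto simp: density_def)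
    have psd\<sigma>: "psd r \<sigma>" and tr\<sigma>: "mat_trace \<sigma> = 1" using \<sigma> by (auto simp: density_def)
    have \<rho>c: "\<rho> \<in> carrier_mat (N * r) (N * r)" and \<sigma>c: "\<sigma> \<in> carrier_mat r r"
      using psd\<rho> psd\<sigma> by (auto simp: psd_def)
    have r0: "0 < r" using tr\<sigma> \<sigma>c by (cases r) (auto simp: mat_trace_def)
    \<comment> \<open>The shift \<open>1/r\<close> adds trace \<open>1\<close> in total, so the
      squared norm of \<open>L\<close> is \<open>2\<close> for every dimension
      \<open>r\<close>.\<close>
    have \<delta>: "0 < 1 / real r" using r0 by simp
    obtain L H where L: "L \<in> carrier_mat r r" and Hc: "H \<in> carrier_mat r r" and HL: "H * L = 1\<^sub>m r"
      and LL: "\<forall>s<r. \<forall>t<r.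
        (\<Sum>u<r. L $$ (s, u) * cnj (L $$ (t, u))) = \<sigma> $$ (s, t) + (if s = t then of_real (1 / real r) else 0)"
      and frobL: "frob_sq L = Re (mat_trace \<sigma>) + real r * (1 / real r)"
      by (rule psd_shift_factor[OF psd\<sigma> \<delta>]) (rule that)
    have frobL: "frob_sq L = 2" using frobL tr\<sigma> r0 by simp
    let ?L = "kron (1\<^sub>m N) L" and ?H = "kron (1\<^sub>m N) H"
    have Lc: "?L \<in> carrier_mat (N * r) (N * r)" and Hc': "?H \<in> carrier_mat (N * r) (N * r)"
      using L Hc by auto
    have HL': "?H * ?L = 1\<^sub>m (N * r)"
      using kron_mult[OF one_carrier_mat Hc one_carrier_mat L] by (simp add: HL kron_one)
    then have LH': "?L * ?H = 1\<^sub>m (N * r)" by (rule mat_mult_left_right_inverse[OF Hc' Lc])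
    \<comment> \<open>The inverse of \<open>1 \<otimes> L\<close> is applied on one side only, so
      \<open>X\<close> need not be Hermitian; the moment bound holds for arbitrary matrices.\<close>
    define X where "X = ?H * \<rho>"
    have X: "X \<in> carrier_mat (N * r) (N * r)" unfolding X_def using Hc' \<rho>c by (rule mult_carrier_mat)
    have \<rho>X: "\<rho> = ?L * X"
      unfolding X_def using Lc Hc' \<rho>c LH' by (simp flip: assoc_mult_mat)
    have "Re (quad (N * r) \<rho> x) \<le> 2 powr \<mu> * (\<Sum>j<N * r. (cmod (\<Sum>i<N * r. cnj (?L $$ (i, j)) * x i))\<^sup>2)" for x
      using \<delta> by (intro kron_one_dominates[OF \<sigma>c \<rho>c dom _ _ L LL]) auto
    then have frobX: "frob_sq X \<le> 2 powr \<mu>"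
      using frob_sq_inverse_mult_le[OF psd\<rho> Lc Hc' HL', of "2 powr \<mu>"] by (simp add: X_def tr\<rho>)
    define E where "E = extractor_output M Mc lab D V r X - ideal_output N M D r X"
    have "frob_sq E = (\<Sum>s<r. \<Sum>t<r. \<Sum>i<D. \<Sum>m<M. (cmod (deviation N M Mc lab (V i) r X m s t))\<^sup>2) / (real D)\<^sup>2"
      unfolding E_def by (rule frob_sq_extractor_error[OF Vc X lt])
    also have "\<dots> \<le> (\<Sum>s<r. \<Sum>t<r. real (card PP) * (\<Sum>x<N. \<Sum>y<N. (cmod (X $$ (x * r + s, y * r + t)))\<^sup>2)) / (real D)\<^sup>2"
      unfolding D_def V_def
      by (intro divide_right_mono sum_mono perm_mub_deviation_moment[OF N mub lab PP P]) simp
    also have "(\<Sum>s<r. \<Sum>t<r. real (card PP) * (\<Sum>x<N. \<Sum>y<N. (cmod (X $$ (x * r + s, y * r + t)))\<^sup>2))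
       = real (card PP) * frob_sq X"
    proof -
      let ?g = "\<lambda>x s y t. (cmod (X $$ (x * r + s, y * r + t)))\<^sup>2"
      have "(\<Sum>s<r. \<Sum>t<r. \<Sum>x<N. \<Sum>y<N. ?g x s y t) = (\<Sum>s<r. \<Sum>x<N. \<Sum>t<r. \<Sum>y<N. ?g x s y t)"
        by (intro sum.cong refl sum.swap)
      also have "\<dots> = (\<Sum>x<N. \<Sum>s<r. \<Sum>t<r. \<Sum>y<N. ?g x s y t)" by (rule sum.swap)
      also have "\<dots> = (\<Sum>x<N. \<Sum>s<r. \<Sum>y<N. \<Sum>t<r. ?g x s y t)"
        by (intro sum.cong refl sum.swap)
      also have "\<dots> = frob_sq X" by (rule frob_sq_split[OF X, symmetric])
      finally show ?thesis by (simp only: sum_distrib_left[symmetric])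
    qed
    \<comment> \<open>Since \<open>D = card PP * (N + 1)\<close>, the factor \<open>card PP\<close>
      cancels once and an extra \<open>1 / (N + 1)\<close> remains: the gain from averaging over the
      bases.\<close>
    also have "real (card PP) * frob_sq X / (real D)\<^sup>2 = frob_sq X / (real D * real (N + 1))"
    proof -
      have "c * x / (c * n)\<^sup>2 = x / (c * n * n)" if "0 < c" for c x n :: real
        using that by (simp add: power2_eq_square)
      then show ?thesis unfolding D_def of_nat_mult using cardP of_nat_0_less_iff by blast
    qed
    finally have frobE: "frob_sq E \<le> frob_sq X / (real D * real (N + 1))" .
    let ?K = "kron (kron (1\<^sub>m M) L) (1\<^sub>m D)"
    have KM: "kron (1\<^sub>m M) L \<in> carrier_mat (M * r) (M * r)" using L by simp
    have K: "?K \<in> carrier_mat (M * r * D) (M * r * D)" using KM by simp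
    have Ec: "E \<in> carrier_mat (M * r * D) (M * r * D)" unfolding E_def by (intro minus_carrier_mat) simp
    have frobK: "frob_sq ?K = 2 * real M * real D"
      by (simp add: frob_sq_kron[OF KM one_carrier_mat] frob_sq_kron[OF one_carrier_mat L] frob_sq_one frobL)
    have "extractor_output M Mc lab D V r \<rho> - ideal_output N M D r \<rho> = ?K * E"
      unfolding E_def by (subst (1 2) \<rho>X) (rule extractor_error_factor[OF Vc X L lt])
    then have "trace_norm (extractor_output M Mc lab D V r \<rho> - ideal_output N M D r \<rho>)
        \<le> sqrt (frob_sq ?K) * sqrt (frob_sq E)"
      using trace_norm_mult_le[OF K Ec] by simp
    also have "\<dots> = sqrt (2 * real M * real D * frob_sq E)"
      by (simp add: frobK real_sqrt_mult)
    also have "\<dots> \<le> sqrt (\<epsilon>\<^sup>2)"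
    proof (rule real_sqrt_le_mono)
      have "2 * real M * real D * frob_sq E \<le> 2 * real M * real D * (frob_sq X / (real D * real (N + 1)))"
        by (intro mult_left_mono frobE) simp
      also have "\<dots> = 2 * real M * frob_sq X / real (N + 1)" using D0 by simp
      also have "\<dots> \<le> 2 * real M * 2 powr (1 - k) / real (N + 1)"
        using frobX \<mu> by (intro divide_right_mono mult_left_mono order_trans[OF frobX]) auto
      also have "\<dots> = 4 * real M * 2 powr (- k) / real (N + 1)"
        by (simp add: powr_diff powr_minus_divide)
      also have "\<dots> \<le> (real N * 2 powr k * \<epsilon>\<^sup>2) * 2 powr (- k) / real (N + 1)"
        by (intro divide_right_mono mult_right_mono Mle) auto
      also have "\<dots> = \<epsilon>\<^sup>2 * (real N / real (N + 1))"
        by (simp add: powr_minus_divide)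
      also have "\<dots> \<le> \<epsilon>\<^sup>2" by (intro mult_left_le) auto
      finally show "2 * real M * real D * frob_sq E \<le> \<epsilon>\<^sup>2" .
    qed
    also have "\<dots> = \<epsilon>" using \<epsilon> by simp
    finally show ?thesis .
  qed
  show ?thesis
    unfolding strong_qc_extractor_def D_def[symmetric] V_def[symmetric]
    using lab k \<epsilon> D0 V main by blast
qed

text \<open>The output size enters as an upper bound on \<open>log 2 (real M)\<close>, as its exact
  value need not be the logarithm of a divisor of \<open>N\<close>. Any enumeration \<open>P\<close>
  of the permutations may serve as the seed order.\<close>

theorem theorem4p28:
  fixes N M Mc :: nat
    and lab :: "nat \<Rightarrow> nat \<Rightarrow> nat"
    and B :: "nat \<Rightarrow> nat \<Rightarrow> complex vec"
    and U :: "nat \<Rightarrow> complex mat"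
    and k \<epsilon> :: real
    and enc :: "nat \<Rightarrow> 'x::{field,finite}"
  assumes "0 < N"
    and "full_mub N B U"
    and "tensor_labelling N M Mc lab"
    and "- log 2 (real N) \<le> k" and "k \<le> log 2 (real N)" and "0 < \<epsilon>"
    and "log 2 (real M) \<le> min (log 2 (real N)) (log 2 (real N) + k - 2 * log 2 (1 / \<epsilon>) - 2)"
  shows
    "(\<forall>PP P. pairwise_independent {..<N} PP \<longrightarrow> bij_betw P {..<card PP} PP \<longrightarrow>
        strong_qc_extractor N M Mc lab k \<epsilon> (card PP * (N + 1)) (perm_mub_unitary N P U) \<and>
        log 2 (real (card PP * (N + 1))) = log 2 (real (card PP)) + log 2 (real (N + 1))) \<and>
     (bij_betw enc {..<N} (UNIV :: 'x set) \<longrightarrow>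
        pairwise_independent {..<N} (affine_perms N enc) \<and>
        (\<forall>P. bij_betw P {..<card (affine_perms N enc)} (affine_perms N enc) \<longrightarrow>
           strong_qc_extractor N M Mc lab k \<epsilon>
             (card (affine_perms N enc) * (N + 1)) (perm_mub_unitary N P U)) \<and>
        log 2 (real (card (affine_perms N enc) * (N + 1))) \<le> 3 * log 2 (real N))"
proof (intro conjI allI impI)
  have ext: "strong_qc_extractor N M Mc lab k \<epsilon> (card PP * (N + 1)) (perm_mub_unitary N P U)"
    if "pairwise_independent {..<N} PP" "bij_betw P {..<card PP} PP" for PP P
    using assms(7) by (intro perm_mub_extractor[OF assms(1-6) _ that]) simp
  fix PP P assume PP: "pairwise_independent {..<N} PP" and P: "bij_betw P {..<card PP} PP"
  show "strong_qc_extractor N M Mc lab k \<epsilon> (card PP * (N + 1)) (perm_mub_unitary N P U)"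
    using PP P by (rule ext)
  have "0 < real (card PP)" using PP by (auto simp: pairwise_independent_def card_gt_0_iff)
  then show "log 2 (real (card PP * (N + 1))) = log 2 (real (card PP)) + log 2 (real (N + 1))"
    unfolding of_nat_mult by (intro log_mult_pos) auto
next
  assume enc: "bij_betw enc {..<N} (UNIV :: 'x set)"
  show pi: "pairwise_independent {..<N} (affine_perms N enc)"
    by (rule affine_perms_pairwise_independent[OF enc])
  show "strong_qc_extractor N M Mc lab k \<epsilon> (card (affine_perms N enc) * (N + 1)) (perm_mub_unitary N P U)"
    if "bij_betw P {..<card (affine_perms N enc)} (affine_perms N enc)" for P
    using assms(7) by (intro perm_mub_extractor[OF assms(1-6) _ pi that]) simp
  have card: "card (affine_perms N enc) = N * (N - 1)"
    by (rule affine_perms_pairwise_independent[OF enc])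
  have pos: "0 < card (affine_perms N enc)"
    using pi by (auto simp: pairwise_independent_def card_gt_0_iff)
  then have pos': "0 < card (affine_perms N enc) * (N + 1)" by simp
  \<comment> \<open>\<open>N * (N - 1) * (N + 1)\<close> is \<open>N^3 - N\<close>, so three times
    the input size bounds the seed size.\<close>
  have "card (affine_perms N enc) * (N + 1) \<le> N ^ 3"
    unfolding card by (cases N) (simp_all add: power3_eq_cube algebra_simps)
  then have "real (card (affine_perms N enc) * (N + 1)) \<le> real N ^ 3"
    by (metis of_nat_le_iff of_nat_power)
  then have "log 2 (real (card (affine_perms N enc) * (N + 1))) \<le> log 2 (real N ^ 3)"
    using pos' assms(1) by (subst log_le_cancel_iff) (simp_all del: of_nat_mult)
  also have "\<dots> = 3 * log 2 (real N)" using assms(1) by (simp add: log_nat_power)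
  finally show "log 2 (real (card (affine_perms N enc) * (N + 1))) \<le> 3 * log 2 (real N)" .
qed

end
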